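(* Let $n,s\in\mathbb{N}$ with $s=O(\sqrt{n})$. Then $h(n,s)=\Omega((n/\log s)^{1/3})$. On the other hand, \[ h(n,s)=\begin{cases} O(\sqrt{n}) & \text{for } 2\le s\le n^{3/8},\\ O((n/s)^{4/5}) & \text{for } n^{3/8}\le s=O(\sqrt{n}).\end{cases} \]
   Context: For $n\ge s\ge 2$, $h(n,s)$ is the largest integer such that every set $P\subseteq\mathbb{R}^2$ of $n$ points with at most $s$ points on any line contains a subset of $h(n,s)$ points such that all lines through two points of the subset have pairwise distinct slopes (the subset determines pairwise distinct slopes). Here $s=s(n)$ may depend on $n$, and asymptotic notation refers to $n\to\infty$. *)

theory Defs
  imports "HOL-Analysis.Analysis" "HOL-Library.Landau_Symbols"
begin

text \<open>Slope of the line through two distinct points of the plane; vertical lines all share the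
  slope \<open>\<infinity>\<close>, so equality of slopes is parallelism. The value for equal points is junk.\<close>

definition slope :: "real \<times> real \<Rightarrow> real \<times> real \<Rightarrow> ereal" where
  "slope p q =
     (if fst p = fst q then \<infinity> else ereal ((snd q - snd p) / (fst q - fst p)))"

text \<open>Slopes are compared over unordered pairs of points rather than over lines as sets, so three
  collinear points already violate the condition.\<close>

definition distinct_slopes :: "(real \<times> real) set \<Rightarrow> bool" where
  "distinct_slopes Q \<longleftrightarrow>
     (\<forall>a\<in>Q. \<forall>b\<in>Q. \<forall>c\<in>Q. \<forall>d\<in>Q.
        a \<noteq> b \<longrightarrow> c \<noteq> d \<longrightarrow> {a, b} \<noteq> {c, d} \<longrightarrow> slope a b \<noteq> slope c d)"

definition at_most_on_line :: "nat \<Rightarrow> (real \<times> real) set \<Rightarrow> bool" where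
  "at_most_on_line s P \<longleftrightarrow>
     (\<forall>L. affine L \<and> aff_dim L = 1 \<longrightarrow> card (P \<inter> L) \<le> s)"

text \<open>For \<open>s \<ge> 2\<close> the maximum exists: \<open>k = 0\<close> is admissible, and as there are \<open>n\<close>-point sets in
  general position, every admissible \<open>k\<close> is at most \<open>n\<close>.\<close>

definition h :: "nat \<Rightarrow> nat \<Rightarrow> nat" where
  "h n s = (GREATEST k. \<forall>P. finite P \<and> card P = n \<and> at_most_on_line s P \<longrightarrow>
              (\<exists>Q\<subseteq>P. card Q = k \<and> distinct_slopes Q))"

end

theory Submission
  imports Defs "HOL-Real_Asymp.Real_Asymp"
begin

text \<open>
  Lower bound. Put \<open>T = \<Sum> |l|\<^sup>3\<close> over the lines \<open>l\<close> spanned by \<open>P\<close>. Charging a pair of parallel segments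
  to the one on the richer line shows that there are at most \<open>2 n T\<close> of them: on every line parallel
  to \<open>l\<close> and not richer than \<open>l\<close>, an endpoint leaves at most \<open>|l|\<close> choices for the other one.
  Since \<open>s = O(sqrt n)\<close>, the Szemeredi-Trotter theorem bounds the number of lines with at least \<open>k\<close>
  points by \<open>O(n\<^sup>2 / k\<^sup>3)\<close> for all \<open>k \<le> s\<close>, so \<open>T = O(n\<^sup>2 log s)\<close>. A random colour class among
  \<open>r = (n\<^sup>2 log s)\<^bsup>1/3\<^esup>\<close> colours contains few parallel pairs, and deleting a point from each of them
  leaves about \<open>n / r\<close> points. The Szemeredi-Trotter theorem itself is proved with crossing numbers.

  Upper bound. The points \<open>(i, i\<^sup>2)\<close> span only \<open>O(n)\<close> slopes, which gives \<open>O(sqrt n)\<close>. For larger \<open>s\<close>,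
  a random subset of density \<open>s / N\<close> of an \<open>N\<close> by \<open>N\<close> grid with \<open>N\<close> of order \<open>n / s\<close> has at most \<open>s\<close> points
  on every line, while \<open>k\<close> points of the grid with distinct slopes satisfy \<open>k = O(N\<^bsup>4/5\<^esup>)\<close>: for
  \<open>q \<le> N / m\<close>, split the grid into \<open>O((N / m)\<^sup>2)\<close> cells, each a box of side \<open>q m\<close> within a residue class
  modulo \<open>q\<close>. A pair in a common cell differs by \<open>q w\<close> with \<open>|w| < m\<close>, and as slopes are distinct, \<open>w\<close>
  determines the pair and \<open>q\<close>; so there are at most \<open>4 m\<^sup>2\<close> such pairs over all \<open>q\<close>. Take \<open>m = N\<^bsup>3/5\<^esup>\<close>.
\<close>

section \<open>Counting colourings\<close>

text \<open>The constrained functions form a product set whose factors over \<open>J\<close> are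
  singletons.\<close>

lemma card_PiE_prescribed:
  assumes "finite I" "J \<subseteq> I" "\<And>j. j \<in> J \<Longrightarrow> g j \<in> K"
  shows "card {f \<in> I \<rightarrow>\<^sub>E K. \<forall>j\<in>J. f j = g j} = card K ^ (card I - card J)"
proof -
  have "{f \<in> I \<rightarrow>\<^sub>E K. \<forall>j\<in>J. f j = g j} = PiE I (\<lambda>i. if i \<in> J then {g i} else K)"
  proof (intro set_eqI iffI)
    fix f assume f: "f \<in> PiE I (\<lambda>i. if i \<in> J then {g i} else K)"
    have "f i \<in> (if i \<in> J then {g i} else K)" if "i \<in> I" for i
      using PiE_mem[OF f that] .
    hence "f i \<in> K \<and> (i \<in> J \<longrightarrow> f i = g i)" if "i \<in> I" for i
      using that assms(3)[of i] by (cases "i \<in> J") force+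
    thus "f \<in> {f \<in> I \<rightarrow>\<^sub>E K. \<forall>j\<in>J. f j = g j}"
      using f assms(2) by (simp add: PiE_iff subset_iff)
  qed (simp add: PiE_iff)
  also have "card \<dots> = (\<Prod>i\<in>I. if i \<in> J then 1 else card K)"
    using assms by (simp add: card_PiE if_distrib cong: if_cong)
  also have "\<dots> = (\<Prod>i\<in>I-J. card K)"
    using assms by (intro prod.mono_neutral_cong_right) auto
  also have "\<dots> = card K ^ (card I - card J)"
    using assms by (simp add: card_Diff_subset finite_subset)
  finally show ?thesis .
qed

text \<open>The empty set is monochromatic and lies in every colour class at once, so the counts
  below ask for nonempty sets.\<close>

definition monochromatic :: "('a \<Rightarrow> 'b) \<Rightarrow> 'a set \<Rightarrow> bool" where
  "monochromatic f S \<longleftrightarrow> (\<exists>c. \<forall>v\<in>S. f v = c)"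

text \<open>Split by the common colour \<open>c\<close>; the \<open>r\<close> cases are disjoint
  because \<open>S\<close> is nonempty. The quotient reads as the number of colourings times the
  probability \<open>1 / r ^ (card S - 1)\<close>.\<close>

lemma card_monochromatic:
  fixes r :: nat
  assumes "finite V" "S \<subseteq> V" "S \<noteq> {}" "r > 0"
  shows "real (card {f \<in> V \<rightarrow>\<^sub>E {..<r}. monochromatic f S}) = real r ^ card V / real r ^ (card S - 1)"
proof -
  have fS: "finite S" using assms finite_subset by blast
  have "{f \<in> V \<rightarrow>\<^sub>E {..<r}. monochromatic f S}
      = (\<Union>c\<in>{..<r}. {f \<in> V \<rightarrow>\<^sub>E {..<r}. \<forall>v\<in>S. f v = c})" (is "?L = ?R")
  proof
    show "?L \<subseteq> ?R"
    proof
      fix f assume f: "f \<in> ?L"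
      then obtain c where c: "\<forall>v\<in>S. f v = c" by (auto simp: monochromatic_def)
      obtain v where "v \<in> S" using assms by auto
      hence "c < r" using c f assms by (auto simp: PiE_iff)
      thus "f \<in> ?R" using f c by auto
    qed
    show "?R \<subseteq> ?L" by (auto simp: monochromatic_def)
  qed
  hence "card {f \<in> V \<rightarrow>\<^sub>E {..<r}. monochromatic f S} = card ?R" by simp
  also have "\<dots> = (\<Sum>c<r. card {f \<in> V \<rightarrow>\<^sub>E {..<r}. \<forall>v\<in>S. f v = c})"
  proof (rule card_UN_disjoint)
    show "\<forall>i\<in>{..<r}. finite {f \<in> V \<rightarrow>\<^sub>E {..<r}. \<forall>v\<in>S. f v = i}"
      using assms finite_PiE[of V "\<lambda>_. {..<r}"] by simp
    show "\<forall>i\<in>{..<r}. \<forall>j\<in>{..<r}. i \<noteq> j \<longrightarrow>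
      {f \<in> V \<rightarrow>\<^sub>E {..<r}. \<forall>v\<in>S. f v = i} \<inter> {f \<in> V \<rightarrow>\<^sub>E {..<r}. \<forall>v\<in>S. f v = j} = {}"
      using assms(3) by fastforce
  qed simp
  also have "\<dots> = (\<Sum>c<r. r ^ (card V - card S))"
    using card_PiE_prescribed[OF assms(1,2), of _ "{..<r}"] by (intro sum.cong) auto
  finally have eq: "card {f \<in> V \<rightarrow>\<^sub>E {..<r}. monochromatic f S} = r * r ^ (card V - card S)" by simp
  have "card S \<le> card V" "card S > 0" using assms fS by (auto intro: card_mono simp: card_gt_0_iff)
  hence "(card V - card S) + 1 + (card S - 1) = card V" by linarith
  hence "real r ^ card V = real r ^ (card V - card S) * real r * real r ^ (card S - 1)"
    using power_add[of "real r" "card V - card S + 1" "card S - 1"] by simp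
  thus ?thesis using eq assms(4) by simp
qed

text \<open>Linearity of expectation, multiplied by the number of colourings.\<close>

lemma sum_card_monochromatic:
  fixes r :: nat
  assumes "finite V" "finite I" "\<And>i. i \<in> I \<Longrightarrow> S i \<subseteq> V" "\<And>i. i \<in> I \<Longrightarrow> S i \<noteq> {}" "r > 0"
  shows "(\<Sum>f\<in>V \<rightarrow>\<^sub>E {..<r}. real (card {i \<in> I. monochromatic f (S i)}))
       = (\<Sum>i\<in>I. real r ^ card V / real r ^ (card (S i) - 1))"
proof -
  let ?F = "V \<rightarrow>\<^sub>E {..<r}"
  have fin: "finite ?F" using assms by (auto intro: finite_PiE)
  have "(\<Sum>f\<in>?F. real (card {i \<in> I. monochromatic f (S i)}))
      = (\<Sum>f\<in>?F. \<Sum>i\<in>I. if monochromatic f (S i) then 1 else 0)"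
    using assms by (simp add: sum.If_cases Collect_conj_eq)
  also have "\<dots> = (\<Sum>i\<in>I. \<Sum>f\<in>?F. if monochromatic f (S i) then 1 else 0)"
    by (rule sum.swap)
  also have "\<dots> = (\<Sum>i\<in>I. real (card {f \<in> ?F. monochromatic f (S i)}))"
    using fin by (simp add: sum.If_cases Collect_conj_eq)
  also have "\<dots> = (\<Sum>i\<in>I. real r ^ card V / real r ^ (card (S i) - 1))"
    using assms by (intro sum.cong refl card_monochromatic) auto
  finally show ?thesis .
qed

lemma sum_card_colour_classes:
  assumes "finite I" "\<And>i. i \<in> I \<Longrightarrow> S i \<subseteq> V" "\<And>i. i \<in> I \<Longrightarrow> S i \<noteq> {}" "f \<in> V \<rightarrow>\<^sub>E {..<r::nat}"
  shows "(\<Sum>c<r. card {i \<in> I. \<forall>v\<in>S i. f v = c}) = card {i \<in> I. monochromatic f (S i)}"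
proof -
  have "{i \<in> I. monochromatic f (S i)} = (\<Union>c<r. {i \<in> I. \<forall>v\<in>S i. f v = c})" (is "?L = ?R")
  proof
    show "?L \<subseteq> ?R"
    proof
      fix i assume i: "i \<in> ?L"
      then obtain c where c: "\<forall>v\<in>S i. f v = c" by (auto simp: monochromatic_def)
      from i obtain v where v: "v \<in> S i" using assms(3) by blast
      hence "v \<in> V" using i assms(2) by blast
      hence "c < r" using c v PiE_mem[OF assms(4)] by fastforce
      thus "i \<in> ?R" using i c by blast
    qed
    show "?R \<subseteq> ?L" by (auto simp: monochromatic_def)
  qed
  moreover have "card ?R = (\<Sum>c<r. card {i \<in> I. \<forall>v\<in>S i. f v = c})"
  proof (rule card_UN_disjoint)
    show "\<forall>c\<in>{..<r}. \<forall>d\<in>{..<r}. c \<noteq> d \<longrightarrow>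
        {i \<in> I. \<forall>v\<in>S i. f v = c} \<inter> {i \<in> I. \<forall>v\<in>S i. f v = d} = {}"
      using assms(3) by fastforce
  qed (use assms in auto)
  ultimately show ?thesis by simp
qed

text \<open>Deletion method. By averaging, some colouring leaves at most \<open>card P / 2\<close>
  monochromatic sets, so points minus monochromatic sets, summed over the \<open>r\<close> classes,
  is at least \<open>card P / 2\<close>. The best class keeps \<open>card P / (2 * r)\<close> points
  after losing one point of each set inside it.\<close>

lemma deletion:
  fixes S :: "'i \<Rightarrow> 'a set" and r :: nat
  assumes fin: "finite P" "finite I" and S: "\<And>i. i \<in> I \<Longrightarrow> S i \<subseteq> P" "\<And>i. i \<in> I \<Longrightarrow> S i \<noteq> {}"
    and r: "r > 0" and few: "(\<Sum>i\<in>I. 1 / real r ^ (card (S i) - 1)) \<le> real (card P) / 2"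
  shows "\<exists>Q\<subseteq>P. card P \<le> 2 * r * card Q \<and> (\<forall>i\<in>I. \<not> S i \<subseteq> Q)"
proof -
  let ?F = "P \<rightarrow>\<^sub>E {..<r}"
  have finF: "finite ?F" using fin by (auto intro: finite_PiE)
  have cF: "real (card ?F) = real r ^ card P" using fin by (simp add: card_PiE)
  have neF: "?F \<noteq> {}" using r by (simp add: PiE_eq_empty_iff lessThan_empty_iff)
  have "\<exists>f\<in>?F. real (card {i \<in> I. monochromatic f (S i)}) \<le> real (card P) / 2"
  proof (rule ccontr)
    assume "\<not> ?thesis"
    hence "(\<Sum>f\<in>?F. real (card P) / 2) < (\<Sum>f\<in>?F. real (card {i \<in> I. monochromatic f (S i)}))"
      using finF neF by (intro sum_strict_mono) auto
    also have "\<dots> = (\<Sum>i\<in>I. real r ^ card P / real r ^ (card (S i) - 1))"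
      by (rule sum_card_monochromatic[OF fin S r])
    also have "\<dots> = real r ^ card P * (\<Sum>i\<in>I. 1 / real r ^ (card (S i) - 1))"
      by (simp add: sum_distrib_left)
    also have "\<dots> \<le> real r ^ card P * (real (card P) / 2)"
      using few by (intro mult_left_mono) auto
    finally show False using cF by simp
  qed
  then obtain f where f: "f \<in> ?F" "real (card {i \<in> I. monochromatic f (S i)}) \<le> real (card P) / 2"
    by blast
  define A where "A c = {u \<in> P. \<forall>v\<in>{u}. f v = c}" for c
  define B where "B c = {i \<in> I. \<forall>v\<in>S i. f v = c}" for c
  have "(\<Sum>c<r. card (A c)) = card {u \<in> P. monochromatic f {u}}"
    unfolding A_def by (rule sum_card_colour_classes[OF fin(1) _ _ f(1)]) auto
  hence sA: "(\<Sum>c<r. card (A c)) = card P" by (simp add: monochromatic_def)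
  have sB: "(\<Sum>c<r. card (B c)) = card {i \<in> I. monochromatic f (S i)}"
    unfolding B_def by (rule sum_card_colour_classes[OF fin(2) S f(1)])
  have "\<exists>c<r. real (card P) / (2 * real r) \<le> real (card (A c)) - real (card (B c))"
  proof (rule ccontr)
    assume "\<not> ?thesis"
    hence "(\<Sum>c<r. real (card (A c)) - real (card (B c))) < (\<Sum>c<r. real (card P) / (2 * real r))"
      using r by (intro sum_strict_mono) auto
    also have "\<dots> = real (card P) / 2" using r by simp
    finally have "real (\<Sum>c<r. card (A c)) - real (\<Sum>c<r. card (B c)) < real (card P) / 2"
      by (simp add: sum_subtractf)
    thus False using f(2) unfolding sA sB by linarith
  qed
  then obtain c where c: "real (card P) / (2 * real r) \<le> real (card (A c)) - real (card (B c))" by blast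
  define pick where "pick i = (SOME v. v \<in> S i)" for i
  have pick: "pick i \<in> S i" if "i \<in> I" for i
    using S(2)[OF that] unfolding pick_def by (simp add: some_in_eq)
  define Q where "Q = A c - pick ` B c"
  have finA: "finite (A c)" "finite (B c)" using fin by (simp_all add: A_def B_def)
  have "card (A c) - card (B c) \<le> card Q"
    using diff_card_le_card_Diff[of "pick ` B c" "A c"] card_image_le[of "B c" pick] finA
    unfolding Q_def by (meson diff_le_mono2 finite_imageI order_trans)
  hence "real (card (A c)) - real (card (B c)) \<le> real (card Q)" by linarith
  hence "real (card P) / (2 * real r) \<le> real (card Q)" using c by linarith
  hence "real (card P) \<le> real (2 * r * card Q)" using r by (simp add: field_simps)
  hence "card P \<le> 2 * r * card Q" by (simp only: of_nat_le_iff)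
  moreover have "\<not> S i \<subseteq> Q" if i: "i \<in> I" for i
  proof
    assume sub: "S i \<subseteq> Q"
    hence "i \<in> B c" using i by (auto simp: Q_def A_def B_def)
    hence "pick i \<notin> Q" by (simp add: Q_def)
    thus False using sub pick[OF i] by blast
  qed
  moreover have "Q \<subseteq> P" by (auto simp: Q_def A_def)
  ultimately show ?thesis by blast
qed

section \<open>Plane graphs with straight edges\<close>

type_synonym point = "real \<times> real"

definition lx :: "point \<times> point \<Rightarrow> real" where "lx e = fst (fst e)"
definition rx :: "point \<times> point \<Rightarrow> real" where "rx e = fst (snd e)"
definition gradient :: "point \<times> point \<Rightarrow> real" where
  "gradient e = (snd (snd e) - snd (fst e)) / (rx e - lx e)"
text \<open>The affine function of the whole line through \<open>e\<close>, not only of the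
  segment.\<close>

definition height :: "point \<times> point \<Rightarrow> real \<Rightarrow> real" where
  "height e x = snd (fst e) + gradient e * (x - lx e)"

text \<open>Only interiors matter: a shared end alone is no crossing, while overlapping collinear
  edges do cross.\<close>

definition crosses :: "point \<times> point \<Rightarrow> point \<times> point \<Rightarrow> bool" where
  "crosses e f \<longleftrightarrow> (\<exists>x. lx e < x \<and> x < rx e \<and> lx f < x \<and> x < rx f \<and> height e x = height f x)"

lemma height_lx [simp]: "height e (lx e) = snd (fst e)"
  by (simp add: height_def)

lemma height_rx: "lx e < rx e \<Longrightarrow> height e (rx e) = snd (snd e)"
  by (simp add: height_def gradient_def)

lemma continuous_on_height: "continuous_on A (height e)"
  unfolding height_def by (intro continuous_intros)

text \<open>Intermediate values: the difference has no zero in the open interval. The starting point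
  \<open>x0\<close> may be an end of the interval.\<close>

lemma height_less_extend:
  assumes "height e x0 < height f x0" "lo \<le> x0" "x0 \<le> hi"
    and ne: "\<And>x. lo < x \<Longrightarrow> x < hi \<Longrightarrow> height e x \<noteq> height f x"
    and "lo < x" "x < hi"
  shows "height e x < height f x"
proof (rule ccontr)
  let ?g = "\<lambda>x. height f x - height e x"
  assume "\<not> height e x < height f x"
  hence neg: "?g x < 0" using ne[of x] assms by force
  have cont: "continuous_on A ?g" for A
    by (intro continuous_intros continuous_on_height)
  have pos: "?g x0 > 0" using assms by simp
  show False
  proof (cases "x0 < x")
    case True
    then obtain z where z: "x0 \<le> z" "z \<le> x" "?g z = 0"
      using IVT2'[of ?g x 0 x0] cont neg pos by force
    hence "z \<noteq> x0" "z \<noteq> x" using pos neg by auto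
    thus False using ne[of z] z assms(2,6) by force
  next
    case False
    then obtain z where z: "x \<le> z" "z \<le> x0" "?g z = 0"
      using IVT'[of ?g x 0 x0] cont neg pos by force
    hence "z \<noteq> x0" "z \<noteq> x" using pos neg by auto
    thus False using ne[of z] z assms(3,5) by force
  qed
qed

text \<open>A reverse strict inequality at \<open>x\<close> would spread to the midpoint, where the
  inequality at \<open>x0\<close> already arrives.\<close>

lemma height_le_extend:
  assumes "height e x0 < height f x0" "lo \<le> x0" "x0 \<le> hi" "lo < hi"
    and ne: "\<And>x. lo < x \<Longrightarrow> x < hi \<Longrightarrow> height e x \<noteq> height f x"
    and "lo \<le> x" "x \<le> hi"
  shows "height e x \<le> height f x"
proof (rule ccontr)
  assume "\<not> ?thesis"
  hence lt: "height f x < height e x" by simp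
  let ?m = "(lo + hi) / 2"
  have "height f ?m < height e ?m"
    by (rule height_less_extend[OF lt, of lo hi]) (use assms ne in \<open>fastforce\<close>)+
  moreover have "height e ?m < height f ?m"
    by (rule height_less_extend[OF assms(1), of lo hi]) (use assms ne in \<open>fastforce\<close>)+
  ultimately show False by simp
qed

text \<open>Distinct abscissae identify a vertex by its first coordinate. Excluding vertices inside
  edges rules out overlaps of distinct collinear edges.\<close>

locale geometric_graph =
  fixes V :: "point set" and E :: "(point \<times> point) set"
  assumes finite_V: "finite V" and inj_V: "inj_on fst V" and E_sub: "E \<subseteq> V \<times> V"
    and lx_less: "e \<in> E \<Longrightarrow> lx e < rx e"
    and no_interior: "\<lbrakk>e \<in> E; v \<in> V; lx e < fst v; fst v < rx e\<rbrakk> \<Longrightarrow> height e (fst v) \<noteq> snd v"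
begin

lemma finite_E: "finite E"
  using E_sub finite_V finite_subset by blast

lemma ends_in_V: "e \<in> E \<Longrightarrow> fst e \<in> V" "e \<in> E \<Longrightarrow> snd e \<in> V"
  using E_sub by auto

lemma V_eqI: "u \<in> V \<Longrightarrow> v \<in> V \<Longrightarrow> fst u = fst v \<Longrightarrow> u = v"
  using inj_V by (auto dest: inj_onD)

lemma subgraph:
  assumes "V' \<subseteq> V" "E' \<subseteq> E" "E' \<subseteq> V' \<times> V'"
  shows "geometric_graph V' E'"
proof
  show "finite V'" "inj_on fst V'" using assms finite_V inj_V by (auto intro: finite_subset inj_on_subset)
  show "lx e < rx e" if "e \<in> E'" for e using that assms lx_less by blast
  show "height e (fst v) \<noteq> snd v" if "e \<in> E'" "v \<in> V'" "lx e < fst v" "fst v < rx e" for e v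
    using that assms no_interior by blast
qed (use assms in simp)

end

section \<open>Noncrossing straight edges: a linear bound on their number\<close>

locale plane_graph = geometric_graph +
  assumes plane: "e \<in> E \<Longrightarrow> f \<in> E \<Longrightarrow> e \<noteq> f \<Longrightarrow> \<not> crosses e f"
begin

text \<open>Just to the right of the common end the two edges overlap, and overlapping counts as
  crossing.\<close>

lemma same_left_gradient:
  assumes "e \<in> E" "f \<in> E" "fst e = fst f" "gradient e = gradient f"
  shows "e = f"
proof (rule ccontr)
  assume ne: "e \<noteq> f"
  have lx: "lx e = lx f" using assms by (simp add: lx_def)
  let ?x = "(lx e + min (rx e) (rx f)) / 2"
  have "lx e < ?x \<and> ?x < rx e \<and> lx f < ?x \<and> ?x < rx f"
    using lx_less[OF assms(1)] lx_less[OF assms(2)] lx by (auto simp: min_def)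
  moreover have "height e ?x = height f ?x" using assms lx by (simp add: height_def)
  ultimately have "crosses e f" unfolding crosses_def by blast
  thus False using plane assms ne by blast
qed

definition next_above :: "point \<times> point \<Rightarrow> point \<times> point \<Rightarrow> bool" where
  "next_above e e' \<longleftrightarrow> e \<in> E \<and> e' \<in> E \<and> fst e' = fst e \<and> gradient e < gradient e' \<and>
     (\<forall>g\<in>E. fst g = fst e \<longrightarrow> gradient e < gradient g \<longrightarrow> gradient e' \<le> gradient g)"

text \<open>Every edge \<open>e\<close> that is not the steepest one leaving its left end is charged to the leftmost vertex
  in the wedge between \<open>e\<close> and the next steeper edge. A vertex is charged at most once by an edge ending
  there, and at most once by an edge passing below it.\<close>

definition wedge :: "point \<times> point \<Rightarrow> point \<times> point \<Rightarrow> point set" where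
  "wedge e e' = {v \<in> V. lx e < fst v \<and> fst v \<le> rx e \<and> fst v \<le> rx e' \<and>
     height e (fst v) \<le> snd v \<and> snd v \<le> height e' (fst v)}"

definition wedge_tip :: "point \<times> point \<Rightarrow> point \<times> point \<Rightarrow> point \<Rightarrow> bool" where
  "wedge_tip e e' w \<longleftrightarrow> next_above e e' \<and> w \<in> wedge e e' \<and> (\<forall>v\<in>wedge e e'. fst w \<le> fst v)"

text \<open>Of the two right ends, the one further to the left belongs to the wedge.\<close>

lemma wedge_tip_exists:
  assumes "next_above e e'"
  shows "\<exists>w. wedge_tip e e' w"
proof -
  have e: "e \<in> E" "e' \<in> E" "fst e' = fst e" "gradient e < gradient e'"
    using assms by (auto simp: next_above_def)
  have lx: "lx e' = lx e" using e by (simp add: lx_def)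
  have le: "height e x \<le> height e' x" if "lx e \<le> x" for x
    using e lx that by (auto simp: height_def intro!: mult_right_mono)
  have "wedge e e' \<noteq> {}"
  proof (cases "rx e \<le> rx e'")
    case True
    hence "snd e \<in> wedge e e'"
      using e ends_in_V lx_less[OF e(1)] le[of "rx e"] height_rx[of e]
      by (auto simp: wedge_def rx_def)
    thus ?thesis by auto
  next
    case False
    hence "snd e' \<in> wedge e e'"
      using e ends_in_V lx_less[OF e(2)] le[of "rx e'"] height_rx[of e'] lx
      by (auto simp: wedge_def rx_def)
    thus ?thesis by auto
  qed
  moreover have "finite (wedge e e')" using finite_V by (simp add: wedge_def)
  ultimately have "wedge_tip e e' (arg_min_on fst (wedge e e'))"
    using arg_min_if_finite(1)[of "wedge e e'" fst] arg_min_least[of "wedge e e'" _ fst] assms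
    by (simp add: wedge_tip_def)
  thus ?thesis ..
qed

text \<open>Followed to the left from the tip, \<open>f\<close> cannot cross \<open>e\<close> or
  \<open>e'\<close> and stays between them. So it starts at a vertex of the wedge before the tip, or
  passes through the apex, or starts at the apex with a gradient strictly between theirs; each is
  impossible.\<close>

lemma no_edge_enters_wedge:
  assumes "wedge_tip e e' w" "f \<in> E" "lx f < fst w" "fst w \<le> rx f"
    and lt: "height e (fst w) < height f (fst w)" "height f (fst w) < height e' (fst w)"
  shows False
proof -
  have na: "next_above e e'" and w: "w \<in> wedge e e'" and wmin: "\<And>v. v \<in> wedge e e' \<Longrightarrow> fst w \<le> fst v"
    using assms(1) by (auto simp: wedge_tip_def)
  have e: "e \<in> E" "e' \<in> E" "fst e' = fst e" "gradient e < gradient e'"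
    using na by (auto simp: next_above_def)
  have lx: "lx e' = lx e" using e by (simp add: lx_def)
  have wx: "lx e < fst w" "fst w \<le> rx e" "fst w \<le> rx e'" using w by (auto simp: wedge_def)
  have fe: "f \<noteq> e" "f \<noteq> e'" using lt by auto
  let ?lo = "max (lx e) (lx f)"
  have between: "height e x \<le> height f x \<and> height f x \<le> height e' x" if "?lo \<le> x" "x \<le> fst w" for x
  proof
    show "height e x \<le> height f x"
    proof (rule height_le_extend[OF lt(1), of ?lo "fst w"])
      fix x assume "?lo < x" "x < fst w"
      thus "height e x \<noteq> height f x"
        using plane[OF e(1) assms(2)] fe wx assms(3,4) by (auto simp: crosses_def)
    qed (use that wx assms in auto)
    show "height f x \<le> height e' x"
    proof (rule height_le_extend[OF lt(2), of ?lo "fst w"])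
      fix x assume "?lo < x" "x < fst w"
      thus "height f x \<noteq> height e' x"
        using plane[OF assms(2) e(2)] fe wx assms(3,4) lx by (auto simp: crosses_def)
    qed (use that wx assms in auto)
  qed
  consider "lx f > lx e" | "lx f < lx e" | "lx f = lx e" by linarith
  thus False
  proof cases
    case 1
    have "fst f \<in> wedge e e'"
      using between[of "lx f"] 1 ends_in_V[OF assms(2)] assms(3) wx
      by (auto simp: wedge_def lx_def[of f, symmetric])
    thus False using wmin[of "fst f"] assms(3) by (simp add: lx_def)
  next
    case 2
    have "height f (lx e) = snd (fst e)"
      using between[of "lx e"] 2 wx height_lx[of e] height_lx[of e'] e lx by auto
    thus False using no_interior[OF assms(2), of "fst e"] ends_in_V[OF e(1)] 2 wx assms
      by (auto simp: lx_def)
  next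
    case 3
    have ff: "fst f = fst e"
      using 3 V_eqI ends_in_V[OF e(1)] ends_in_V[OF assms(2)] by (auto simp: lx_def)
    have "gradient e < gradient f" "gradient f < gradient e'"
      using lt ff wx e 3 lx by (auto simp: height_def mult_less_cancel_right)
    thus False using na ff assms(2) by (force simp: next_above_def)
  qed
qed

text \<open>Both \<open>e1'\<close> and \<open>e2'\<close> pass strictly above \<open>w\<close>. If
  one were lower there, it would enter the wedge below the other; so they meet above
  \<open>w\<close>, hence coincide, and \<open>e1\<close>, \<open>e2\<close> share their left end as
  well.\<close>

lemma wedge_tip_left:
  assumes t: "wedge_tip e1 e1' w" "wedge_tip e2 e2' w" and "snd e1 = w" "snd e2 = w"
  shows "e1 = e2"
proof -
  have above: "fst w < rx e' \<and> snd w < height e' (fst w) \<and> height e (fst w) = snd w \<and> e' \<in> E \<and> lx e' < fst w"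
    if "wedge_tip e e' w" "snd e = w" for e e'
  proof -
    have e: "e \<in> E" "e' \<in> E" "fst e' = fst e" "gradient e < gradient e'" "w \<in> wedge e e'"
      using that by (auto simp: wedge_tip_def next_above_def)
    have lx: "lx e' = lx e" using e by (simp add: lx_def)
    have "fst w \<noteq> rx e'"
    proof
      assume "fst w = rx e'"
      hence "snd e' = w" using V_eqI[of "snd e'" w] ends_in_V(2)[OF e(1)] ends_in_V(2)[OF e(2)] that
        by (simp add: rx_def)
      hence "e = e'" using that e by (simp add: prod_eq_iff)
      thus False using e by simp
    qed
    hence 1: "fst w < rx e'" using e by (auto simp: wedge_def)
    moreover have "height e (fst w) = snd w" using height_rx[of e] lx_less[OF e(1)] that by (simp add: rx_def)
    moreover have "lx e' < fst w" using e lx by (auto simp: wedge_def)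
    moreover have "snd w < height e' (fst w)"
      using no_interior[OF e(2), of w] 1 calculation e by (auto simp: wedge_def)
    ultimately show ?thesis using e by auto
  qed
  note a1 = above[OF t(1) assms(3)] and a2 = above[OF t(2) assms(4)]
  have "height e1' (fst w) = height e2' (fst w)"
    using no_edge_enters_wedge[OF t(1), of e2'] no_edge_enters_wedge[OF t(2), of e1'] a1 a2
    by (cases rule: linorder_cases[of "height e1' (fst w)" "height e2' (fst w)"]) auto
  hence "e1' = e2'" using a1 a2 plane[of e1' e2'] by (auto simp: crosses_def)
  hence "fst e1 = fst e2" using t by (auto simp: wedge_tip_def next_above_def)
  thus ?thesis using assms by (simp add: prod_eq_iff)
qed

text \<open>Both edges pass strictly below \<open>w\<close>. The higher one would enter the wedge
  above the lower one, so they agree at \<open>fst w\<close>, inside both edges.\<close>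

lemma wedge_tip_below:
  assumes t: "wedge_tip e1 e1' w" "wedge_tip e2 e2' w" and "snd e1 \<noteq> w" "snd e2 \<noteq> w"
  shows "e1 = e2"
proof -
  have below: "e \<in> E \<and> lx e < fst w \<and> fst w < rx e \<and> height e (fst w) < snd w \<and> snd w \<le> height e' (fst w)"
    if "wedge_tip e e' w" "snd e \<noteq> w" for e e'
  proof -
    have e: "e \<in> E" "w \<in> wedge e e'"
      using that by (auto simp: wedge_tip_def next_above_def)
    have "fst w \<noteq> rx e"
      using V_eqI[of w "snd e"] ends_in_V e that by (auto simp: rx_def wedge_def)
    hence "fst w < rx e" using e by (auto simp: wedge_def)
    thus ?thesis using e no_interior[OF e(1), of w] by (force simp: wedge_def)
  qed
  note b1 = below[OF t(1) assms(3)] and b2 = below[OF t(2) assms(4)]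
  have "height e1 (fst w) = height e2 (fst w)"
    using no_edge_enters_wedge[OF t(1), of e2] no_edge_enters_wedge[OF t(2), of e1] b1 b2
    by (cases rule: linorder_cases[of "height e1 (fst w)" "height e2 (fst w)"]) auto
  thus ?thesis using b1 b2 plane[of e1 e2] by (auto simp: crosses_def)
qed

text \<open>Three classes of edges each inject into \<open>V\<close>: those ending at their tip and
  those passing below it, via \<open>W\<close>, and those steepest at their left end, via that
  end.\<close>

lemma card_E_le: "card E \<le> 3 * card V"
proof -
  define N where "N = {e \<in> E. \<exists>e'. next_above e e'}"
  have "\<forall>e\<in>N. \<exists>w. \<exists>e'. wedge_tip e e' w"
    using wedge_tip_exists unfolding N_def by blast
  then obtain W where W: "\<And>e. e \<in> N \<Longrightarrow> \<exists>e'. wedge_tip e e' (W e)" by metis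
  have WV: "W e \<in> V" if "e \<in> N" for e
    using W[OF that] by (auto simp: wedge_tip_def wedge_def)
  have "inj_on W {e \<in> N. snd e = W e}"
  proof (rule inj_onI)
    fix e f assume e: "e \<in> {e \<in> N. snd e = W e}" "f \<in> {e \<in> N. snd e = W e}" "W e = W f"
    then obtain e' f' where "wedge_tip e e' (W e)" "wedge_tip f f' (W e)" using W[of e] W[of f] by auto
    thus "e = f" by (rule wedge_tip_left) (use e in auto)
  qed
  hence 1: "card {e \<in> N. snd e = W e} \<le> card V"
    by (rule card_inj_on_le[OF _ _ finite_V]) (use WV in blast)
  have "inj_on W {e \<in> N. snd e \<noteq> W e}"
  proof (rule inj_onI)
    fix e f assume e: "e \<in> {e \<in> N. snd e \<noteq> W e}" "f \<in> {e \<in> N. snd e \<noteq> W e}" "W e = W f"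
    then obtain e' f' where "wedge_tip e e' (W e)" "wedge_tip f f' (W e)" using W[of e] W[of f] by auto
    thus "e = f" by (rule wedge_tip_below) (use e in auto)
  qed
  hence 2: "card {e \<in> N. snd e \<noteq> W e} \<le> card V"
    by (rule card_inj_on_le[OF _ _ finite_V]) (use WV in blast)
  have top: "gradient f \<le> gradient e" if "e \<in> E - N" "f \<in> E" "fst f = fst e" for e f
  proof (rule ccontr)
    assume lt: "\<not> gradient f \<le> gradient e"
    let ?G = "{g \<in> E. fst g = fst e \<and> gradient e < gradient g}"
    have "f \<in> ?G" using that lt by simp
    hence G: "finite ?G" "?G \<noteq> {}" using finite_E by (simp, blast)
    have "next_above e (arg_min_on gradient ?G)"
      using arg_min_if_finite(1)[OF G, of gradient] arg_min_least[OF G, of _ gradient] that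
      by (auto simp: next_above_def)
    thus False using that unfolding N_def by blast
  qed
  have "inj_on fst (E - N)"
  proof (rule inj_onI)
    fix e f assume e: "e \<in> E - N" "f \<in> E - N" "fst e = fst f"
    hence "gradient e = gradient f" using top[of e f] top[of f e] by simp
    thus "e = f" using same_left_gradient e by blast
  qed
  hence 3: "card (E - N) \<le> card V"
    by (rule card_inj_on_le[OF _ _ finite_V]) (use ends_in_V in blast)
  have "E = {e \<in> N. snd e = W e} \<union> {e \<in> N. snd e \<noteq> W e} \<union> (E - N)"
    unfolding N_def by blast
  hence "card E \<le> card ({e \<in> N. snd e = W e} \<union> {e \<in> N. snd e \<noteq> W e}) + card (E - N)"
    using card_Un_le[of "{e \<in> N. snd e = W e} \<union> {e \<in> N. snd e \<noteq> W e}" "E - N"] by simp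
  also have "\<dots> \<le> 3 * card V"
    using card_Un_le[of "{e \<in> N. snd e = W e}" "{e \<in> N. snd e \<noteq> W e}"] 1 2 3 by linarith
  finally show ?thesis .
qed

end

section \<open>Crossings\<close>

text \<open>Ordered pairs, so every crossing is counted twice.\<close>

definition crossings :: "(point \<times> point) set \<Rightarrow> ((point \<times> point) \<times> (point \<times> point)) set" where
  "crossings E = {p. fst p \<in> E \<and> snd p \<in> E \<and> fst p \<noteq> snd p \<and> crosses (fst p) (snd p)}"

lemma finite_crossings: "finite E \<Longrightarrow> finite (crossings E)"
  by (rule finite_subset[of _ "E \<times> E"]) (simp_all add: crossings_def mem_Times_iff subset_iff)

lemma height_eqD:
  assumes "height e x = height f x" "height e y = height f y" "x \<noteq> y"
  shows "gradient e = gradient f" "height e = height f"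
proof -
  have "gradient e * (x - y) = height e x - height e y" by (simp add: height_def algebra_simps)
  also have "\<dots> = gradient f * (x - y)" using assms by (simp add: height_def algebra_simps)
  finally show g: "gradient e = gradient f" using assms by simp
  show "height e = height f"
    using assms(1) unfolding height_def g by (auto simp: algebra_simps)
qed

text \<open>Removing one edge of a crossing pair costs one edge and at least one crossing; without
  crossings the linear bound applies.\<close>

lemma card_edges_le_crossings:
  assumes "geometric_graph V E"
  shows "card E \<le> 3 * card V + card (crossings E)"
  using assms
proof (induction "card E" arbitrary: E rule: less_induct)
  case less
  interpret geometric_graph V E by fact
  show ?case
  proof (cases "crossings E = {}")
    case True
    interpret plane_graph V E
    proof
      fix e f assume "e \<in> E" "f \<in> E" "e \<noteq> f"
      moreover have "(e, f) \<notin> crossings E" using True by simp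
      ultimately show "\<not> crosses e f" unfolding crossings_def by simp
    qed
    show ?thesis using card_E_le by simp
  next
    case False
    then obtain e f where ef: "(e, f) \<in> crossings E" by (metis ex_in_conv surj_pair)
    hence e: "e \<in> E" by (simp add: crossings_def)
    have card: "card (E - {e}) < card E" using e finite_E by (metis card_Diff1_less)
    have "geometric_graph V (E - {e})" by (rule subgraph) (use E_sub in auto)
    hence "card (E - {e}) \<le> 3 * card V + card (crossings (E - {e}))"
      using less.hyps[OF card] by simp
    moreover have "card (crossings (E - {e})) < card (crossings E)"
    proof (rule psubset_card_mono)
      have "(e, f) \<notin> crossings (E - {e})" by (simp add: crossings_def)
      moreover have "crossings (E - {e}) \<subseteq> crossings E" unfolding crossings_def by blast
      ultimately show "crossings (E - {e}) \<subset> crossings E" using ef by blast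
    qed (simp add: finite_crossings finite_E)
    ultimately show ?thesis using e finite_E by (simp add: card_Diff_singleton)
  qed
qed

text \<open>\<open>R\<close> stands for the number \<open>r ^ card V\<close> of colourings; the
  inequality is multiplied by \<open>r / R\<close>.\<close>

lemma amplify_arith:
  fixes R r e v x :: real
  assumes "R > 0" "r > 0" "e * (R / r) \<le> R * (3 * v) + x * (R / r ^ 3)"
  shows "e \<le> 3 * v * r + x / r\<^sup>2"
proof -
  have "e = e * (R / r) * (r / R)" using assms by simp
  also have "\<dots> \<le> (R * (3 * v) + x * (R / r ^ 3)) * (r / R)"
    by (rule mult_right_mono) (use assms in auto)
  also have "\<dots> = R * (3 * v) * (r / R) + x * (R / r ^ 3) * (r / R)" by (simp only: distrib_right)
  also have "R * (3 * v) * (r / R) = 3 * v * r" using assms by simp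
  also have "x * (R / r ^ 3) * (r / R) = x / r\<^sup>2"
    using assms by (simp add: power2_eq_square power3_eq_cube)
  finally show ?thesis .
qed

section \<open>The crossing inequality, amplified by random colourings\<close>

context geometric_graph
begin

text \<open>Of two overlapping edges on one line, one has an end inside the other unless both ends
  agree.\<close>

lemma crossing_gradients:
  assumes "e \<in> E" "f \<in> E" "e \<noteq> f" "crosses e f"
  shows "gradient e \<noteq> gradient f"
proof
  assume g: "gradient e = gradient f"
  obtain x where x: "lx e < x" "x < rx e" "lx f < x" "x < rx f" "height e x = height f x"
    using assms by (auto simp: crosses_def)
  have h: "height e y = height f y" for y
    using x(5) g by (simp add: height_def algebra_simps)
  have l: "\<not> lx e < lx f"
    using no_interior[OF assms(1), of "fst f"] ends_in_V[OF assms(2)] x h[of "lx f"]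
    by (auto simp flip: lx_def)
  have l': "\<not> lx f < lx e"
    using no_interior[OF assms(2), of "fst e"] ends_in_V[OF assms(1)] x h[of "lx e"]
    by (auto simp flip: lx_def)
  have r: "\<not> rx e < rx f"
    using no_interior[OF assms(2), of "snd e"] ends_in_V[OF assms(1)] x h[of "rx e"] height_rx[of e]
    by (auto simp flip: rx_def)
  have r': "\<not> rx f < rx e"
    using no_interior[OF assms(1), of "snd f"] ends_in_V[OF assms(2)] x h[of "rx f"] height_rx[of f]
    by (auto simp flip: rx_def)
  have "fst e = fst f" "snd e = snd f"
    using l l' r r' by (intro V_eqI ends_in_V assms; simp add: lx_def rx_def)+
  thus False using assms(3) by (simp add: prod_eq_iff)
qed

text \<open>A common left or right end together with the crossing would force equal gradients. Four
  distinct ends give a crossing the survival probability \<open>1 / r ^ 3\<close>.\<close>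

lemma card_crossing_ends:
  assumes "e \<in> E" "f \<in> E" "e \<noteq> f" "crosses e f"
  shows "card {fst e, snd e, fst f, snd f} = 4"
proof -
  obtain x where x: "lx e < x" "x < rx e" "lx f < x" "x < rx f" "height e x = height f x"
    using assms by (auto simp: crosses_def)
  note g = crossing_gradients[OF assms]
  have "fst e \<noteq> snd e" "fst f \<noteq> snd f" "fst e \<noteq> snd f" "snd e \<noteq> fst f"
    using x by (auto simp: lx_def rx_def)
  moreover have "fst e \<noteq> fst f"
    using height_eqD(1)[OF x(5), of "lx e"] g x height_lx[of e] height_lx[of f]
    by (auto simp: lx_def)
  moreover have "snd e \<noteq> snd f"
    using height_eqD(1)[OF x(5), of "rx e"] g x height_rx[of e] height_rx[of f]
    by (auto simp: rx_def)
  ultimately show ?thesis by auto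
qed

text \<open>Crossing lemma with a free parameter \<open>r\<close>. The linear bound is summed over
  all colour classes, so each vertex counts once, while on average an edge survives with probability
  \<open>1 / r\<close> and a crossing with \<open>1 / r ^ 3\<close>.\<close>

lemma card_edges_le_amplified:
  assumes "r > 0"
  shows "real (card E) \<le> 3 * real (card V) * real r + real (card (crossings E)) / (real r)\<^sup>2"
proof -
  let ?F = "V \<rightarrow>\<^sub>E {..<r}"
  let ?SE = "\<lambda>e::point \<times> point. {fst e, snd e}"
  let ?SX = "\<lambda>p::(point \<times> point) \<times> (point \<times> point).
    {fst (fst p), snd (fst p), fst (snd p), snd (snd p)}"
  have SE_V: "?SE e \<subseteq> V" if "e \<in> E" for e using ends_in_V[OF that] by simp
  have SX_V: "?SX p \<subseteq> V" if "p \<in> crossings E" for p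
    using that ends_in_V[of "fst p"] ends_in_V[of "snd p"] by (simp add: crossings_def)
  have mono_le: "card {e \<in> E. monochromatic f (?SE e)}
      \<le> 3 * card V + card {p \<in> crossings E. monochromatic f (?SX p)}" if f: "f \<in> ?F" for f
  proof -
    have "card {e \<in> E. monochromatic f (?SE e)} = (\<Sum>c<r. card {e \<in> E. \<forall>v\<in>?SE e. f v = c})"
      by (rule sum_card_colour_classes[OF finite_E SE_V _ f, symmetric]) simp_all
    also have "\<dots> \<le> (\<Sum>c<r. 3 * card {u \<in> V. \<forall>v\<in>{u}. f v = c}
        + card {p \<in> crossings E. \<forall>v\<in>?SX p. f v = c})"
    proof (rule sum_mono)
      fix c
      let ?V = "{u \<in> V. \<forall>v\<in>{u}. f v = c}" and ?E = "{e \<in> E. \<forall>v\<in>?SE e. f v = c}"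
      have "geometric_graph ?V ?E"
      proof (rule subgraph)
        show "?E \<subseteq> ?V \<times> ?V"
        proof
          fix e assume "e \<in> ?E"
          thus "e \<in> ?V \<times> ?V" using ends_in_V[of e] by (simp add: mem_Times_iff)
        qed
      qed simp_all
      from card_edges_le_crossings[OF this]
      have "card ?E \<le> 3 * card ?V + card (crossings ?E)" .
      also have "crossings ?E = {p \<in> crossings E. \<forall>v\<in>?SX p. f v = c}"
        by (rule set_eqI) (simp add: crossings_def, blast)
      finally show "card ?E \<le> 3 * card ?V + card {p \<in> crossings E. \<forall>v\<in>?SX p. f v = c}" .
    qed
    also have "\<dots> = 3 * (\<Sum>c<r. card {u \<in> V. \<forall>v\<in>{u}. f v = c})
        + (\<Sum>c<r. card {p \<in> crossings E. \<forall>v\<in>?SX p. f v = c})"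
      by (simp add: sum.distrib sum_distrib_left)
    also have "(\<Sum>c<r. card {u \<in> V. \<forall>v\<in>{u}. f v = c}) = card {u \<in> V. monochromatic f {u}}"
      by (rule sum_card_colour_classes[OF finite_V _ _ f]) auto
    also have "(\<Sum>c<r. card {p \<in> crossings E. \<forall>v\<in>?SX p. f v = c})
        = card {p \<in> crossings E. monochromatic f (?SX p)}"
      by (rule sum_card_colour_classes[OF finite_crossings[OF finite_E] SX_V _ f]) simp_all
    finally show ?thesis by (simp add: monochromatic_def)
  qed
  have le: "(\<Sum>f\<in>?F. real (card {e \<in> E. monochromatic f (?SE e)}))
      \<le> (\<Sum>f\<in>?F. 3 * real (card V) + real (card {p \<in> crossings E. monochromatic f (?SX p)}))"
  proof (rule sum_mono)
    fix f assume "f \<in> ?F"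
    from mono_le[OF this] have "real (card {e \<in> E. monochromatic f (?SE e)})
        \<le> real (3 * card V + card {p \<in> crossings E. monochromatic f (?SX p)})"
      by (simp only: of_nat_le_iff)
    thus "real (card {e \<in> E. monochromatic f (?SE e)})
        \<le> 3 * real (card V) + real (card {p \<in> crossings E. monochromatic f (?SX p)})" by simp
  qed
  have rhs: "(\<Sum>f\<in>?F. 3 * real (card V) + real (card {p \<in> crossings E. monochromatic f (?SX p)}))
      = real r ^ card V * (3 * real (card V))
      + (\<Sum>f\<in>?F. real (card {p \<in> crossings E. monochromatic f (?SX p)}))"
    using finite_V by (simp add: sum.distrib card_PiE)
  have "(\<Sum>f\<in>?F. real (card {p \<in> crossings E. monochromatic f (?SX p)}))
      = (\<Sum>p\<in>crossings E. real r ^ card V / real r ^ (card (?SX p) - 1))"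
    by (rule sum_card_monochromatic[OF finite_V finite_crossings[OF finite_E] SX_V _ assms]) simp_all
  also have "\<dots> = (\<Sum>p\<in>crossings E. real r ^ card V / real r ^ 3)"
  proof (intro sum.cong refl)
    fix p assume "p \<in> crossings E"
    hence "card (?SX p) = 4" using card_crossing_ends[of "fst p" "snd p"] by (simp add: crossings_def)
    thus "real r ^ card V / real r ^ (card (?SX p) - 1) = real r ^ card V / real r ^ 3" by simp
  qed
  finally have sumX: "(\<Sum>f\<in>?F. real (card {p \<in> crossings E. monochromatic f (?SX p)}))
      = real (card (crossings E)) * (real r ^ card V / real r ^ 3)" by (simp only: sum_constant)
  have "(\<Sum>f\<in>?F. real (card {e \<in> E. monochromatic f (?SE e)}))
      = (\<Sum>e\<in>E. real r ^ card V / real r ^ (card (?SE e) - 1))"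
    by (rule sum_card_monochromatic[OF finite_V finite_E SE_V _ assms]) simp_all
  also have "\<dots> = (\<Sum>e\<in>E. real r ^ card V / real r)"
  proof (intro sum.cong refl)
    fix e assume "e \<in> E"
    hence "fst e \<noteq> snd e" using lx_less[of e] by (auto simp: lx_def rx_def)
    thus "real r ^ card V / real r ^ (card (?SE e) - 1) = real r ^ card V / real r" by simp
  qed
  finally have sumE: "(\<Sum>f\<in>?F. real (card {e \<in> E. monochromatic f (?SE e)}))
      = real (card E) * (real r ^ card V / real r)" by (simp only: sum_constant)
  have pos: "0 < real r ^ card V" "0 < real r" using assms by simp_all
  show ?thesis by (rule amplify_arith[OF pos le[unfolded rhs sumX sumE]])
qed

end

section \<open>Rich lines\<close>

text \<open>The cross product of \<open>b - a\<close> and \<open>c - a\<close>, which vanishes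
  exactly when the three points are collinear.\<close>

definition turn :: "point \<Rightarrow> point \<Rightarrow> point \<Rightarrow> real" where
  "turn a b c = (fst b - fst a) * (snd c - snd a) - (snd b - snd a) * (fst c - fst a)"

lemma turn_same [simp]: "turn a b a = 0" "turn a b b = 0"
  by (simp_all add: turn_def)

lemma turn_transfer:
  assumes "a \<noteq> b" "turn a b c = 0" "turn a b d = 0" "turn a b x = 0"
  shows "turn c d x = 0"
proof (cases "fst a = fst b")
  case True
  hence "snd b - snd a \<noteq> 0" using assms(1) by (simp add: prod_eq_iff)
  hence "fst c = fst a" "fst d = fst a" "fst x = fst a"
    using assms True by (simp_all add: turn_def)
  thus ?thesis by (simp add: turn_def)
next
  case False
  define m where "m = (snd b - snd a) / (fst b - fst a)"
  have "snd y - snd a = m * (fst y - fst a)" if "turn a b y = 0" for y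
    using that False by (simp add: turn_def m_def field_simps)
  from this[OF assms(2)] this[OF assms(3)] this[OF assms(4)]
  have s: "snd c = snd a + m * (fst c - fst a)" "snd d = snd a + m * (fst d - fst a)"
    "snd x = snd a + m * (fst x - fst a)" by simp_all
  show ?thesis unfolding turn_def s by (simp add: algebra_simps)
qed

text \<open>A line is represented by its trace on \<open>P\<close>, so that counting lines is
  counting finite sets. For \<open>a = b\<close> this is all of \<open>P\<close>.\<close>

definition line_of :: "point set \<Rightarrow> point \<Rightarrow> point \<Rightarrow> point set" where
  "line_of P a b = {c \<in> P. turn a b c = 0}"

definition lines :: "point set \<Rightarrow> point set set" where
  "lines P = {l. \<exists>a\<in>P. \<exists>b\<in>P. a \<noteq> b \<and> l = line_of P a b}"

lemma line_of_eq:
  assumes "a \<noteq> b" "c \<noteq> d" "turn a b c = 0" "turn a b d = 0"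
  shows "line_of P a b = line_of P c d"
proof -
  have "turn c d a = 0" "turn c d b = 0" using turn_transfer[OF assms(1,3,4)] by simp_all
  hence "turn a b x = 0 \<longleftrightarrow> turn c d x = 0" for x
    using turn_transfer[OF assms(1,3,4), of x] turn_transfer[OF assms(2), of a b x] by blast
  thus ?thesis by (simp add: line_of_def)
qed

lemma lines_eq_line_of:
  assumes "l \<in> lines P" "a \<in> l" "b \<in> l" "a \<noteq> b"
  shows "l = line_of P a b"
  using assms line_of_eq[of _ _ a b P] by (fastforce simp: lines_def line_of_def)

lemma lines_subset: "l \<in> lines P \<Longrightarrow> l \<subseteq> P"
  by (force simp: lines_def line_of_def)

lemma finite_lines: "finite P \<Longrightarrow> finite (lines P)"
  by (rule finite_subset[of _ "Pow P"]) (use lines_subset in blast)+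

lemma line_of_in_lines: "a \<in> P \<Longrightarrow> b \<in> P \<Longrightarrow> a \<noteq> b \<Longrightarrow> line_of P a b \<in> lines P"
  by (auto simp: lines_def)

lemma turn_eq_0_iff_height:
  assumes "lx e < rx e"
  shows "turn (fst e) (snd e) c = 0 \<longleftrightarrow> height e (fst c) = snd c"
proof -
  have "turn (fst e) (snd e) c = (rx e - lx e) * (snd c - height e (fst c))"
    using assms by (simp add: turn_def height_def gradient_def lx_def rx_def field_simps)
  thus ?thesis using assms by auto
qed

section \<open>The graph of consecutive points on rich lines\<close>

definition consecutive :: "point set \<Rightarrow> (point \<times> point) set" where
  "consecutive l = {e. fst e \<in> l \<and> snd e \<in> l \<and> lx e < rx e \<and> (\<forall>c\<in>l. \<not> (lx e < fst c \<and> fst c < rx e))}"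

text \<open>Every point of \<open>l\<close> except the rightmost one, \<open>b\<close>, starts an
  edge to its right neighbour \<open>nxt\<close>.\<close>

lemma card_consecutive:
  assumes "finite l" "inj_on fst l"
  shows "card l - 1 \<le> card (consecutive l)"
proof (cases "l = {}")
  case False
  define m where "m = Max (fst ` l)"
  have m: "fst a \<le> m" if "a \<in> l" for a using that assms by (simp add: m_def)
  have "m \<in> fst ` l" using False assms unfolding m_def by (intro Max_in) auto
  then obtain b where b: "b \<in> l" "fst b = m" by blast
  define nxt where "nxt a = arg_min_on fst {c \<in> l. fst a < fst c}" for a :: point
  have nxt: "nxt a \<in> l" "fst a < fst (nxt a)" "\<And>c. c \<in> l \<Longrightarrow> fst a < fst c \<Longrightarrow> fst (nxt a) \<le> fst c"
    if "a \<in> l - {b}" for a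
  proof -
    have "fst a \<noteq> fst b" using that b inj_onD[OF assms(2), of a b] by blast
    hence "b \<in> {c \<in> l. fst a < fst c}" using m[of a] that b by simp
    hence ne: "{c \<in> l. fst a < fst c} \<noteq> {}" by blast
    have fin: "finite {c \<in> l. fst a < fst c}" using assms by simp
    show "nxt a \<in> l" "fst a < fst (nxt a)"
      using arg_min_if_finite(1)[OF fin ne, of fst] unfolding nxt_def by blast+
    show "fst (nxt a) \<le> fst c" if "c \<in> l" "fst a < fst c" for c
      using arg_min_least[OF fin ne, of c fst] that unfolding nxt_def by simp
  qed
  have "card (l - {b}) \<le> card (consecutive l)"
  proof (rule card_inj_on_le)
    show "inj_on (\<lambda>a. (a, nxt a)) (l - {b})" by (intro inj_onI) simp
    show "(\<lambda>a. (a, nxt a)) ` (l - {b}) \<subseteq> consecutive l"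
      using nxt by (fastforce simp: consecutive_def lx_def rx_def)
    have "consecutive l \<subseteq> l \<times> l" unfolding consecutive_def by (simp add: mem_Times_iff subset_iff)
    thus "finite (consecutive l)" using assms finite_subset by blast
  qed
  thus ?thesis using b assms by simp
qed simp

text \<open>Szekely's argument: each line of \<open>L\<close> contributes at least
  \<open>k - 1\<close> edges, and an ordered pair of lines carries at most one crossing; then the
  amplified crossing inequality applies.\<close>

lemma rich_lines_ineq_inj_fst:
  fixes k :: nat
  assumes "finite P" "inj_on fst P" "r > 0"
  defines "L \<equiv> {l \<in> lines P. k \<le> card l}"
  shows "real (card L) * real (k - 1) \<le> 3 * real (card P) * real r + (real (card L))\<^sup>2 / (real r)\<^sup>2"
proof -
  define E where "E = (\<Union>l\<in>L. consecutive l)"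
  have L: "l \<in> lines P" "k \<le> card l" if "l \<in> L" for l using that by (simp_all add: L_def)
  have finL: "finite L" using finite_lines[OF assms(1)] by (simp add: L_def)
  have lP: "l \<subseteq> P" if "l \<in> L" for l using lines_subset[OF L(1)[OF that]] .
  have finl: "finite l" if "l \<in> L" for l using lP[OF that] assms(1) finite_subset by blast
  have cons: "fst e \<in> l" "snd e \<in> l" "lx e < rx e" "fst e \<noteq> snd e"
    "\<And>c. c \<in> l \<Longrightarrow> lx e < fst c \<Longrightarrow> fst c < rx e \<Longrightarrow> False" if "e \<in> consecutive l" for e l
    using that by (auto simp: consecutive_def lx_def rx_def)
  have leq: "l = line_of P (fst e) (snd e)" if "l \<in> L" "e \<in> consecutive l" for e l
    using lines_eq_line_of[OF L(1)[OF that(1)]] cons[OF that(2)] by simp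
  have mem_l: "c \<in> l \<longleftrightarrow> c \<in> P \<and> height e (fst c) = snd c" if "l \<in> L" "e \<in> consecutive l" for e l c
    using turn_eq_0_iff_height[OF cons(3)[OF that(2)], of c]
    by (subst leq[OF that]) (simp add: line_of_def)
  have EP: "E \<subseteq> P \<times> P"
  proof
    fix e assume "e \<in> E"
    then obtain l where "l \<in> L" "e \<in> consecutive l" by (auto simp: E_def)
    thus "e \<in> P \<times> P" using cons[of e l] lP[of l] by (auto simp: mem_Times_iff)
  qed
  interpret geometric_graph P E
  proof
    show "lx e < rx e" if "e \<in> E" for e using that cons(3) unfolding E_def by blast
    show "height e (fst v) \<noteq> snd v" if v: "e \<in> E" "v \<in> P" "lx e < fst v" "fst v < rx e" for e v
    proof -
      obtain l where l: "l \<in> L" "e \<in> consecutive l" using v(1) unfolding E_def by blast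
      thus ?thesis using mem_l[OF l, of v] cons(5)[OF l(2), of v] v by blast
    qed
  qed (fact assms EP)+
  have "card E = (\<Sum>l\<in>L. card (consecutive l))"
    unfolding E_def
  proof (rule card_UN_disjoint[OF finL])
    have "consecutive l \<subseteq> l \<times> l" for l unfolding consecutive_def by (simp add: mem_Times_iff subset_iff)
    thus "\<forall>l\<in>L. finite (consecutive l)" using finl by (meson finite_SigmaI finite_subset)
    \<comment> \<open>The two ends of an edge determine its line.\<close>
    show "\<forall>l\<in>L. \<forall>l'\<in>L. l \<noteq> l' \<longrightarrow> consecutive l \<inter> consecutive l' = {}"
    proof (intro ballI impI, rule ccontr)
      fix l l' assume l: "l \<in> L" "l' \<in> L" "l \<noteq> l'" "consecutive l \<inter> consecutive l' \<noteq> {}"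
      then obtain e where e: "e \<in> consecutive l" "e \<in> consecutive l'" by blast
      show False using leq[OF l(1) e(1)] leq[OF l(2) e(2)] l(3) by metis
    qed
  qed
  also have "\<dots> \<ge> (\<Sum>l\<in>L. k - 1)"
  proof (rule sum_mono)
    fix l assume l: "l \<in> L"
    have "card l - 1 \<le> card (consecutive l)"
      by (rule card_consecutive[OF finl[OF l] inj_on_subset[OF assms(2) lP[OF l]]])
    thus "k - 1 \<le> card (consecutive l)" using L(2)[OF l] by linarith
  qed
  finally have cE: "card L * (k - 1) \<le> card E" by simp
  define line where "line e = line_of P (fst e) (snd e)" for e
  have lineL: "line e \<in> L \<and> e \<in> consecutive (line e)" if e: "e \<in> E" for e
  proof -
    obtain l where l: "l \<in> L" "e \<in> consecutive l" using e unfolding E_def by blast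
    have "line e = l" using leq[OF l] by (simp add: line_def)
    thus ?thesis using l by simp
  qed
  have same_height: "height e = height e'" if "e \<in> E" "e' \<in> E" "line e = line e'" for e e'
  proof -
    have e: "line e \<in> L" "e \<in> consecutive (line e)" "e' \<in> consecutive (line e)"
      using lineL[OF that(1)] lineL[OF that(2)] that(3) by simp_all
    have "height e (lx e') = height e' (lx e')" "height e (rx e') = height e' (rx e')"
      using mem_l[OF e(1,2), of "fst e'"] mem_l[OF e(1,2), of "snd e'"]
        mem_l[OF e(1,3), of "fst e'"] mem_l[OF e(1,3), of "snd e'"] cons(1,2)[OF e(3)]
      by (simp_all add: lx_def rx_def)
    thus ?thesis by (rule height_eqD(2)) (use cons(3)[OF e(3)] in simp)
  qed
  \<comment> \<open>Otherwise one edge would have an end strictly inside the other, although its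
    ends are consecutive on the line.\<close>
  have same_edge: "e = e'" if "e \<in> E" "e' \<in> E" "line e = line e'" "lx e < x" "x < rx e" "lx e' < x" "x < rx e'"
    for e e' x
  proof -
    have e: "line e \<in> L" "e \<in> consecutive (line e)" "e' \<in> consecutive (line e)"
      using lineL[OF that(1)] lineL[OF that(2)] that(3) by simp_all
    have "lx e = lx e'"
      using cons(5)[OF e(2) cons(1)[OF e(3)]] cons(5)[OF e(3) cons(1)[OF e(2)]] that(4-)
      by (cases rule: linorder_cases[of "lx e" "lx e'"]) (auto simp flip: lx_def)
    moreover have "rx e = rx e'"
      using cons(5)[OF e(2) cons(2)[OF e(3)]] cons(5)[OF e(3) cons(2)[OF e(2)]] that(4-)
      by (cases rule: linorder_cases[of "rx e" "rx e'"]) (auto simp flip: rx_def)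
    ultimately have "fst e = fst e'" "snd e = snd e'"
      by (intro V_eqI ends_in_V that; simp add: lx_def rx_def)+
    thus ?thesis by (simp add: prod_eq_iff)
  qed
  have "card (crossings E) \<le> card (L \<times> L)"
  proof (rule card_inj_on_le)
    show "inj_on (\<lambda>p. (line (fst p), line (snd p))) (crossings E)"
    proof (rule inj_onI)
      fix p q assume p: "p \<in> crossings E" and q: "q \<in> crossings E"
        and "(line (fst p), line (snd p)) = (line (fst q), line (snd q))"
      hence l: "line (fst p) = line (fst q)" "line (snd p) = line (snd q)" by simp_all
      have pE: "fst p \<in> E" "snd p \<in> E" "fst p \<noteq> snd p" "crosses (fst p) (snd p)"
        using p by (simp_all add: crossings_def)
      have qE: "fst q \<in> E" "snd q \<in> E" "crosses (fst q) (snd q)"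
        using q by (simp_all add: crossings_def)
      obtain x where x: "lx (fst p) < x" "x < rx (fst p)" "lx (snd p) < x" "x < rx (snd p)"
        "height (fst p) x = height (snd p) x" using pE(4) by (auto simp: crosses_def)
      obtain y where y: "lx (fst q) < y" "y < rx (fst q)" "lx (snd q) < y" "y < rx (snd q)"
        "height (fst q) y = height (snd q) y" using qE(3) by (auto simp: crosses_def)
      \<comment> \<open>Two lines with different gradients meet over a single abscissa, so both
        crossings lie over the same \<open>x\<close>.\<close>
      have "height (fst p) y = height (snd p) y"
        using y(5) same_height[OF pE(1) qE(1) l(1)] same_height[OF pE(2) qE(2) l(2)] by simp
      hence "x = y" using height_eqD(1)[OF x(5)] crossing_gradients[OF pE] by blast
      hence "fst p = fst q" "snd p = snd q"
        using same_edge[OF pE(1) qE(1) l(1), of x] same_edge[OF pE(2) qE(2) l(2), of x] x y by simp_all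
      thus "p = q" by (simp add: prod_eq_iff)
    qed
    show "(\<lambda>p. (line (fst p), line (snd p))) ` crossings E \<subseteq> L \<times> L"
      using lineL by (auto simp: crossings_def)
  qed (simp add: finL)
  hence cX: "card (crossings E) \<le> (card L)\<^sup>2" by (simp add: power2_eq_square card_cartesian_product)
  have "real (card L) * real (k - 1) \<le> real (card E)"
    using cE by (metis of_nat_le_iff of_nat_mult)
  also have "\<dots> \<le> 3 * real (card P) * real r + real (card (crossings E)) / (real r)\<^sup>2"
    by (rule card_edges_le_amplified[OF assms(3)])
  also have "\<dots> \<le> 3 * real (card P) * real r + (real (card L))\<^sup>2 / (real r)\<^sup>2"
    using cX by (intro add_left_mono divide_right_mono) (simp_all flip: of_nat_power)
  finally show ?thesis .
qed

section \<open>Shearing a point set to make its abscissae distinct\<close>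

definition shear :: "real \<Rightarrow> point \<Rightarrow> point" where
  "shear t p = (fst p + t * snd p, snd p)"

lemma inj_shear: "inj (shear t)"
  by (intro injI) (auto simp: shear_def prod_eq_iff)

lemma turn_shear: "turn (shear t a) (shear t b) (shear t c) = turn a b c"
  by (simp add: turn_def shear_def algebra_simps)

text \<open>Two points with different ordinates are aligned vertically by exactly one
  \<open>t\<close>, so only finitely many values are excluded.\<close>

lemma exists_shear_inj_fst:
  assumes "finite P"
  shows "\<exists>t. inj_on fst (shear t ` P)"
proof -
  define Bad where "Bad = (\<lambda>(p, q). - (fst p - fst q) / (snd p - snd q)) ` (P \<times> P)"
  have "finite Bad" using assms by (simp add: Bad_def)
  then obtain t where t: "t \<notin> Bad" using ex_new_if_finite[OF infinite_UNIV_char_0] by blast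
  have "p = q" if p: "p \<in> P" "q \<in> P" "fst p + t * snd p = fst q + t * snd q" for p q
  proof (cases "snd p = snd q")
    case False
    hence "t = - (fst p - fst q) / (snd p - snd q)" using p(3) by (simp add: field_simps)
    hence "t \<in> Bad" unfolding Bad_def using p by (intro image_eqI[of _ _ "(p, q)"]) simp_all
    thus ?thesis using t by blast
  qed (use p in \<open>simp add: prod_eq_iff\<close>)
  hence "inj_on fst (shear t ` P)" by (intro inj_onI) (auto simp: shear_def)
  thus ?thesis ..
qed

lemma line_of_shear: "line_of (shear t ` P) (shear t a) (shear t b) = shear t ` line_of P a b"
  by (auto simp: line_of_def turn_shear)

lemma lines_shear: "lines (shear t ` P) = image (shear t) ` lines P"
proof -
  have "l \<in> lines (shear t ` P) \<longleftrightarrow> l \<in> image (shear t) ` lines P" for l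
    unfolding lines_def image_iff bex_simps
    by (simp add: line_of_shear inj_eq[OF inj_shear]) metis
  thus ?thesis by blast
qed

text \<open>A shear preserves \<open>turn\<close>, so it carries the spanned lines and their sizes
  along.\<close>

lemma rich_lines_ineq:
  fixes k :: nat
  assumes "finite P" "r > 0"
  defines "L \<equiv> {l \<in> lines P. k \<le> card l}"
  shows "real (card L) * real (k - 1) \<le> 3 * real (card P) * real r + (real (card L))\<^sup>2 / (real r)\<^sup>2"
proof -
  obtain t where t: "inj_on fst (shear t ` P)" using exists_shear_inj_fst[OF assms(1)] by blast
  have c: "card (shear t ` A) = card A" for A
    using inj_shear by (meson card_image inj_on_subset subset_UNIV)
  have "{l \<in> lines (shear t ` P). k \<le> card l} = image (shear t) ` L"
    unfolding lines_shear L_def by (auto simp: c)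
  moreover have "card (image (shear t) ` L) = card L"
    by (intro card_image inj_onI) (simp add: inj_image_eq_iff[OF inj_shear])
  ultimately show ?thesis
    using rich_lines_ineq_inj_fst[OF _ t assms(2), of k] assms(1) by (simp add: c)
qed

text \<open>Choose \<open>r\<close> near \<open>e / (6 * n)\<close>, so that the vertex term takes
  at most half of \<open>e\<close> and the crossing term must supply the rest. The constant
  \<open>12 * D\<close> covers the case where \<open>e\<close> is too small for such an
  \<open>r\<close>.\<close>

lemma rich_lines_bound:
  fixes k :: nat and D :: real
  assumes "finite P" "2 \<le> k" "(real k)\<^sup>2 \<le> D * real (card P)" "0 \<le> D"
  shows "real (card {l \<in> lines P. k \<le> card l}) * real k ^ 3 \<le> (2304 + 12 * D) * (real (card P))\<^sup>2"
proof -
  define L where "L = real (card {l \<in> lines P. k \<le> card l})"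
  define n where "n = real (card P)"
  define e where "e = L * real (k - 1)"
  have ineq: "e \<le> 3 * n * real r + L\<^sup>2 / (real r)\<^sup>2" if "r > 0" for r :: nat
    using rich_lines_ineq[OF assms(1) that, of k] by (simp add: L_def n_def e_def)
  have L0: "L \<ge> 0" by (simp add: L_def)
  have kpos: "real k > 0" using assms by simp
  have "n > 0" using assms(3,4) kpos unfolding n_def
    by (metis of_nat_0_le_iff order_le_less mult_zero_right zero_less_power2 not_le less_irrefl)
  have "real (k - 1) \<ge> real k / 2" using assms(2) by simp
  hence e_ge: "e \<ge> L * k / 2" using L0 mult_left_mono[of "real k / 2" "real (k - 1)" L] by (simp add: e_def)
  have e0: "e \<ge> 0" using L0 by (simp add: e_def)
  show ?thesis
  proof (cases "e < 6 * n")
    case True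
    hence "L * k \<le> 12 * n" using e_ge by simp
    \<comment> \<open>Here \<open>L * k\<close> is already linear in \<open>n\<close>, and the
      remaining factor \<open>k ^ 2\<close> costs at most \<open>D * n\<close>.\<close>
    hence "L * k * k\<^sup>2 \<le> 12 * n * (D * n)"
      using assms(3) \<open>n > 0\<close> unfolding n_def[symmetric]
      by (intro mult_mono[of "L * k" "12 * n" "k\<^sup>2" "D * n"]) auto
    also have "\<dots> \<le> (2304 + 12 * D) * n\<^sup>2" by (simp add: power2_eq_square algebra_simps)
    finally show ?thesis unfolding L_def[symmetric] n_def[symmetric]
      by (simp add: power2_eq_square power3_eq_cube mult.assoc)
  next
    case False
    define r where "r = nat \<lfloor>e / (6 * n)\<rfloor>"
    have q: "e / (6 * n) \<ge> 1" using False \<open>n > 0\<close> by simp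
    have r1: "r > 0" using q by (simp add: r_def)
    have r2: "real r \<le> e / (6 * n)" using q by (simp add: r_def)
    have "e / (6 * n) < real r + 1" using q unfolding r_def by linarith
    moreover have "real r \<ge> 1" using r1 by simp
    ultimately have "e / (6 * n) \<le> 2 * real r" by linarith
    hence r3: "e / (12 * n) \<le> real r" by (simp add: field_simps)
    have epos: "e > 0" using False \<open>n > 0\<close> by simp
    have "3 * n * real r \<le> e / 2" using r2 \<open>n > 0\<close> by (simp add: field_simps)
    hence "e / 2 \<le> L\<^sup>2 / (real r)\<^sup>2" using ineq[OF r1] by linarith
    also have "\<dots> \<le> L\<^sup>2 / (e / (12 * n))\<^sup>2"
      using r3 r1 epos \<open>n > 0\<close> by (intro divide_left_mono power_mono mult_pos_pos zero_less_power) auto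
    finally have "e / 2 \<le> L\<^sup>2 / (e / (12 * n))\<^sup>2" .
    hence e3: "e ^ 3 \<le> 288 * n\<^sup>2 * L\<^sup>2"
      using epos \<open>n > 0\<close> by (simp add: field_simps power2_eq_square power3_eq_cube)
    \<comment> \<open>Cubing the factor \<open>1 / 2\<close> turns 288 into
      \<open>2304 = 8 * 288\<close>.\<close>
    have "(L * k / 2) ^ 3 \<le> e ^ 3" using e_ge L0 by (intro power_mono) auto
    hence "L\<^sup>2 * (L * real k ^ 3) \<le> L\<^sup>2 * (2304 * n\<^sup>2)"
      using e3 by (simp add: power2_eq_square power3_eq_cube algebra_simps)
    moreover have "L > 0" using epos L0 unfolding e_def by (cases "L = 0") auto
    ultimately have "L * real k ^ 3 \<le> 2304 * n\<^sup>2" by (simp add: mult_le_cancel_left)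
    also have "\<dots> \<le> (2304 + 12 * D) * n\<^sup>2" using assms(4) by (intro mult_right_mono) auto
    finally show ?thesis unfolding L_def n_def .
  qed
qed

text \<open>The step from \<open>k ^ 3\<close> to \<open>(k + 1) ^ 3\<close> is at most
  \<open>3 * (k + 1) ^ 2\<close>. This expresses a sum of cubes through the numbers of rich
  lines.\<close>

lemma cube_le_sum_squares: "real k ^ 3 \<le> (\<Sum>j=1..k. 3 * (real j)\<^sup>2)"
proof (induction k)
  case (Suc k)
  have "real (Suc k) ^ 3 \<le> real k ^ 3 + 3 * (real (Suc k))\<^sup>2"
    by (simp add: power2_eq_square power3_eq_cube algebra_simps)
  thus ?case using Suc by simp
qed simp

lemma card_line_ge_2:
  assumes "finite P" "l \<in> lines P"
  shows "2 \<le> card l"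
proof -
  obtain a b where ab: "a \<in> P" "b \<in> P" "a \<noteq> b" "l = line_of P a b"
    using assms by (auto simp: lines_def)
  have "{a, b} \<subseteq> l" using ab by (simp add: line_of_def)
  moreover have "finite l" using lines_subset[OF assms(2)] assms(1) finite_subset by blast
  ultimately have "card {a, b} \<le> card l" by (intro card_mono)
  thus ?thesis using ab by simp
qed

text \<open>Summing by layers bounds the left side by the sum of \<open>3 * j ^ 2 * N j\<close>, and
  \<open>N j \<le> M / j ^ 3\<close> leaves the harmonic sum up to \<open>s\<close>.\<close>

lemma sum_cubes_lines_le:
  fixes s :: nat and D :: real
  assumes fin: "finite P" and s: "2 \<le> s" "(real s)\<^sup>2 \<le> D * real (card P)" "0 \<le> D"
    and le: "\<And>l. l \<in> lines P \<Longrightarrow> card l \<le> s"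
  shows "(\<Sum>l\<in>lines P. real (card l) ^ 3) \<le> 9 * (2304 + 12 * D) * (real (card P))\<^sup>2 * ln (real s)"
proof -
  define M where "M = (2304 + 12 * D) * (real (card P))\<^sup>2"
  have M0: "M \<ge> 0" using s(3) by (simp add: M_def)
  define N where "N j = real (card {l \<in> lines P. j \<le> card l})" for j
  have finL: "finite (lines P)" using finite_lines[OF fin] .
  have Nj: "3 * (real j)\<^sup>2 * N j \<le> 3 * M * (1 / real j)" if j: "j \<in> {1..s}" for j
  proof (cases "j = 1")
    case True
    \<comment> \<open>The bound on rich lines starts at 2, but every spanned line has two points, so
      \<open>N 1 = N 2\<close>.\<close>
    have "{l \<in> lines P. j \<le> card l} = {l \<in> lines P. 2 \<le> card l}"
      using True card_line_ge_2[OF fin] by force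
    hence "N j = N 2" by (simp add: N_def)
    moreover have "N 2 * 2 ^ 3 \<le> M"
    proof -
      have "(real 2)\<^sup>2 \<le> (real s)\<^sup>2" using s(1) by (intro power_mono) auto
      hence "(real 2)\<^sup>2 \<le> D * real (card P)" using s(2) by linarith
      from rich_lines_bound[OF fin _ this s(3)] show ?thesis by (simp add: N_def M_def)
    qed
    ultimately show ?thesis using True M0 by (simp add: N_def)
  next
    case False
    hence j2: "2 \<le> j" "j \<le> s" using j by auto
    have "(real j)\<^sup>2 \<le> (real s)\<^sup>2" using j2 by (intro power_mono) auto
    hence "(real j)\<^sup>2 \<le> D * real (card P)" using s(2) by linarith
    from rich_lines_bound[OF fin j2(1) this s(3)] have "N j * real j ^ 3 \<le> M"
      by (simp add: N_def M_def)
    thus ?thesis using j2 by (simp add: field_simps power2_eq_square power3_eq_cube)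
  qed
  have "(\<Sum>l\<in>lines P. real (card l) ^ 3) \<le> (\<Sum>l\<in>lines P. \<Sum>j=1..s. if j \<le> card l then 3 * (real j)\<^sup>2 else 0)"
  proof (rule sum_mono)
    fix l assume l: "l \<in> lines P"
    have "real (card l) ^ 3 \<le> (\<Sum>j=1..card l. 3 * (real j)\<^sup>2)" by (rule cube_le_sum_squares)
    also have "\<dots> = (\<Sum>j=1..s. if j \<le> card l then 3 * (real j)\<^sup>2 else 0)"
      using le[OF l] by (intro sum.mono_neutral_cong_left) auto
    finally show "real (card l) ^ 3 \<le> \<dots>" .
  qed
  also have "\<dots> = (\<Sum>j=1..s. \<Sum>l\<in>lines P. if j \<le> card l then 3 * (real j)\<^sup>2 else 0)"
    by (rule sum.swap)
  also have "\<dots> = (\<Sum>j=1..s. 3 * (real j)\<^sup>2 * N j)"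
    using finL by (intro sum.cong refl) (simp add: N_def sum.If_cases Collect_conj_eq mult.commute)
  also have "\<dots> \<le> (\<Sum>j=1..s. 3 * M * (1 / real j))"
    by (intro sum_mono Nj)
  also have "\<dots> = 3 * M * (\<Sum>j=1..s. 1 / real j)" by (simp only: sum_distrib_left)
  also have "\<dots> \<le> 3 * M * (1 + ln (real s))"
  proof (intro mult_left_mono)
    have "harm s - ln (real s) \<le> 1"
      using decseqD[OF decseq_harm_diff_ln, of 0 "s - 1"] s(1) by (simp add: harm_expand)
    thus "(\<Sum>j=1..s. 1 / real j) \<le> 1 + ln (real s)" by (simp add: harm_def inverse_eq_divide)
  qed (use M0 in simp)
  also have "\<dots> \<le> 3 * M * (3 * ln (real s))"
  proof (intro mult_left_mono)
    \<comment> \<open>The additive 1 is at most \<open>2 * ln s\<close>, whence the factor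
      3.\<close>
    have "1 / 2 \<le> ln (2::real)" using ln2_ge_two_thirds by simp
    also have "\<dots> \<le> ln (real s)" using s(1) by simp
    finally show "1 + ln (real s) \<le> 3 * ln (real s)" by simp
  qed (use M0 in simp)
  also have "\<dots> = 9 * (2304 + 12 * D) * (real (card P))\<^sup>2 * ln (real s)" by (simp add: M_def)
  finally show ?thesis .
qed

section \<open>Parallel pairs of points\<close>

text \<open>A vanishing cross product: free of division and valid for vertical segments. A segment
  with equal ends is parallel to everything.\<close>

definition parallel :: "point \<Rightarrow> point \<Rightarrow> point \<Rightarrow> point \<Rightarrow> bool" where
  "parallel a b c d \<longleftrightarrow> (fst b - fst a) * (snd d - snd c) = (snd b - snd a) * (fst d - fst c)"

lemma parallel_sym: "parallel a b c d \<longleftrightarrow> parallel c d a b"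
  by (auto simp: parallel_def algebra_simps)

text \<open>Through \<open>c\<close> there is only one line parallel to the line through
  \<open>a\<close> and \<open>b\<close>.\<close>

lemma parallel_turn:
  assumes "a \<noteq> b" "parallel a b c d" "parallel a b c x"
  shows "turn c d x = 0"
proof (cases "fst a = fst b")
  case True
  hence "snd b - snd a \<noteq> 0" using assms(1) by (simp add: prod_eq_iff)
  thus ?thesis using assms True by (simp add: parallel_def turn_def)
next
  case False
  define m where "m = (snd b - snd a) / (fst b - fst a)"
  have "snd y - snd c = m * (fst y - fst c)" if "parallel a b c y" for y
    using that False by (simp add: parallel_def m_def field_simps)
  from this[OF assms(2)] this[OF assms(3)]
  show ?thesis by (simp add: turn_def)
qed

text \<open>Its size weighs each ordered pair by the size of its line; \<open>x\<close> may be
  \<open>a\<close> or \<open>b\<close>.\<close>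

definition triples :: "point set \<Rightarrow> (point \<times> point \<times> point) set" where
  "triples P = {(a, b, x). a \<in> P \<and> b \<in> P \<and> a \<noteq> b \<and> x \<in> line_of P a b}"

definition parallel_quads :: "point set \<Rightarrow> (point \<times> point \<times> point \<times> point) set" where
  "parallel_quads P = {(a, b, c, d). a \<in> P \<and> b \<in> P \<and> c \<in> P \<and> d \<in> P \<and> a \<noteq> b \<and> c \<noteq> d \<and> parallel a b c d}"

lemma triples_eq_Sigma:
  "triples P = (\<lambda>((a, b), x). (a, b, x)) ` (SIGMA p:{p \<in> P \<times> P. fst p \<noteq> snd p}. line_of P (fst p) (snd p))"
  by (force simp: triples_def)

lemma finite_line_of: "finite P \<Longrightarrow> finite (line_of P a b)"
  by (simp add: line_of_def)

lemma card_triples: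
  assumes "finite P"
  shows "card (triples P) = (\<Sum>p\<in>{p \<in> P \<times> P. fst p \<noteq> snd p}. card (line_of P (fst p) (snd p)))"
proof -
  have "card (triples P) = card (SIGMA p:{p \<in> P \<times> P. fst p \<noteq> snd p}. line_of P (fst p) (snd p))"
    unfolding triples_eq_Sigma by (intro card_image inj_onI) auto
  also have "\<dots> = (\<Sum>p\<in>{p \<in> P \<times> P. fst p \<noteq> snd p}. card (line_of P (fst p) (snd p)))"
    using assms by (intro card_SigmaI) (auto intro: finite_line_of)
  finally show ?thesis .
qed

lemma card_triples_le:
  assumes "finite P"
  shows "card (triples P) \<le> (\<Sum>l\<in>lines P. card l ^ 3)"
proof -
  have finl: "finite l" if "l \<in> lines P" for l
    using lines_subset[OF that] assms finite_subset by blast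
  have "triples P \<subseteq> (\<Union>l\<in>lines P. l \<times> l \<times> l)"
  proof
    fix t assume "t \<in> triples P"
    then obtain a b x where t: "t = (a, b, x)" "a \<in> P" "b \<in> P" "a \<noteq> b" "x \<in> line_of P a b"
      unfolding triples_def by blast
    hence "t \<in> line_of P a b \<times> line_of P a b \<times> line_of P a b" by (simp add: line_of_def)
    thus "t \<in> (\<Union>l\<in>lines P. l \<times> l \<times> l)" using line_of_in_lines[OF t(2-4)] by blast
  qed
  hence "card (triples P) \<le> card (\<Union>l\<in>lines P. l \<times> l \<times> l)"
    by (intro card_mono) (use finl finite_lines[OF assms] in auto)
  also have "\<dots> \<le> (\<Sum>l\<in>lines P. card (l \<times> l \<times> l))" by (rule card_UN_le[OF finite_lines[OF assms]])
  finally show ?thesis by (simp add: card_cartesian_product power3_eq_cube mult.assoc)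
qed

text \<open>Suppose the line of \<open>c\<close>, \<open>d\<close> is at most as rich as that of
  \<open>a\<close>, \<open>b\<close>. Given \<open>a\<close>, \<open>b\<close>, \<open>c\<close>,
  all choices of \<open>d\<close> lie on one parallel line with at most
  \<open>card (line_of P a b)\<close> points, which sums to
  \<open>card P * card (triples P)\<close>.\<close>

lemma card_parallel_quads:
  assumes fin: "finite P"
  shows "card (parallel_quads P) \<le> 2 * card P * card (triples P)"
proof -
  let ?c = "\<lambda>a b. card (line_of P a b)"
  let ?X = "{p \<in> P \<times> P. fst p \<noteq> snd p}"
  define Z where "Z a b c = {d \<in> P. c \<noteq> d \<and> parallel a b c d \<and> ?c c d \<le> ?c a b}" for a b c
  define G where "G = {(a, b, c, d) \<in> parallel_quads P. ?c c d \<le> ?c a b}"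
  have Z: "card (Z a b c) \<le> ?c a b" if "a \<noteq> b" for a b c
  proof (cases "Z a b c = {}")
    case False
    then obtain d where d: "d \<in> Z a b c" by blast
    have "Z a b c \<subseteq> line_of P c d"
      using parallel_turn[OF that] d unfolding Z_def line_of_def by blast
    hence "card (Z a b c) \<le> ?c c d" by (intro card_mono finite_line_of fin)
    thus ?thesis using d by (simp add: Z_def)
  qed simp
  have finZ: "finite (Z a b c)" for a b c using fin by (simp add: Z_def)
  have "G \<subseteq> (\<lambda>(p, c, d). (fst p, snd p, c, d)) ` (SIGMA p:?X. SIGMA c:P. Z (fst p) (snd p) c)"
  proof
    fix q assume "q \<in> G"
    then obtain a b c d where q: "q = (a, b, c, d)" "(a, b, c, d) \<in> parallel_quads P" "?c c d \<le> ?c a b"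
      unfolding G_def by blast
    hence "((a, b), c, d) \<in> (SIGMA p:?X. SIGMA c:P. Z (fst p) (snd p) c)"
      by (simp add: parallel_quads_def Z_def)
    thus "q \<in> (\<lambda>(p, c, d). (fst p, snd p, c, d)) ` (SIGMA p:?X. SIGMA c:P. Z (fst p) (snd p) c)"
      using q(1) by force
  qed
  hence "card G \<le> card (SIGMA p:?X. SIGMA c:P. Z (fst p) (snd p) c)"
    using fin finZ by (intro surj_card_le finite_SigmaI) auto
  also have "\<dots> = (\<Sum>p\<in>?X. \<Sum>c\<in>P. card (Z (fst p) (snd p) c))"
    using fin finZ by (subst card_SigmaI) (auto intro!: sum.cong card_SigmaI)
  also have "\<dots> \<le> (\<Sum>p\<in>?X. \<Sum>c\<in>P. ?c (fst p) (snd p))"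
    by (intro sum_mono Z) simp
  also have "\<dots> = card P * card (triples P)"
    by (simp add: card_triples[OF fin] sum_distrib_left)
  finally have cG: "card G \<le> card P * card (triples P)" .
  have "finite (parallel_quads P)"
    by (rule finite_subset[of _ "P \<times> P \<times> P \<times> P"]) (use fin in \<open>auto simp: parallel_quads_def\<close>)
  hence finG: "finite G" unfolding G_def by (rule finite_subset[rotated]) blast
  \<comment> \<open>Swapping the two pairs of a quadruple outside \<open>G\<close> lands in
    \<open>G\<close>; this gives the factor 2.\<close>
  have "parallel_quads P \<subseteq> G \<union> (\<lambda>(a, b, c, d). (c, d, a, b)) ` G"
  proof
    fix q assume q: "q \<in> parallel_quads P"
    then obtain a b c d where e: "q = (a, b, c, d)" by (metis prod_cases4)
    show "q \<in> G \<union> (\<lambda>(a, b, c, d). (c, d, a, b)) ` G"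
    proof (cases "?c c d \<le> ?c a b")
      case True
      thus ?thesis using q e by (simp add: G_def)
    next
      case False
      hence "(c, d, a, b) \<in> G"
        using q e by (simp add: G_def parallel_quads_def parallel_sym)
      thus ?thesis using e by force
    qed
  qed
  hence "card (parallel_quads P) \<le> card (G \<union> (\<lambda>(a, b, c, d). (c, d, a, b)) ` G)"
    using finG by (intro card_mono) auto
  also have "\<dots> \<le> card G + card G"
    using card_Un_le[of G "(\<lambda>(a, b, c, d). (c, d, a, b)) ` G"]
      card_image_le[OF finG, of "\<lambda>(a, b, c, d). (c, d, a, b)"] by linarith
  finally show ?thesis using cG by linarith
qed

section \<open>Slopes and affine lines in terms of determinants\<close>

lemma slope_eq_imp_parallel:
  assumes "slope a b = slope c d"
  shows "parallel a b c d"
proof (cases "fst a = fst b \<or> fst c = fst d")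
  case True
  hence "fst a = fst b \<and> fst c = fst d" using assms by (auto simp: slope_def split: if_splits)
  thus ?thesis by (simp add: parallel_def)
next
  case False
  hence "(snd b - snd a) / (fst b - fst a) = (snd d - snd c) / (fst d - fst c)"
    using assms by (simp add: slope_def)
  thus ?thesis using False by (simp add: parallel_def frac_eq_eq mult.commute)
qed

lemma turn_in_affine_hull:
  assumes "a \<noteq> b" "turn a b c = 0"
  shows "c \<in> affine hull {a, b}"
proof -
  define t where "t = (if fst a = fst b then (snd c - snd a) / (snd b - snd a)
    else (fst c - fst a) / (fst b - fst a))"
  have "c = (1 - t) *\<^sub>R a + t *\<^sub>R b"
  proof (cases "fst a = fst b")
    case True
    hence ne: "snd b - snd a \<noteq> 0" using assms(1) by (simp add: prod_eq_iff)
    hence "fst c = fst a" using assms(2) True by (simp add: turn_def)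
    moreover have "t * (snd b - snd a) = snd c - snd a" using True ne by (simp add: t_def)
    ultimately show ?thesis using True by (simp add: prod_eq_iff algebra_simps)
  next
    case False
    hence t: "t * (fst b - fst a) = fst c - fst a" by (simp add: t_def)
    have "(fst b - fst a) * (t * (snd b - snd a)) = (fst b - fst a) * (snd c - snd a)"
      using assms(2) t unfolding turn_def by algebra
    hence "t * (snd b - snd a) = snd c - snd a" using False by simp
    thus ?thesis using t by (simp add: prod_eq_iff algebra_simps)
  qed
  thus ?thesis by (simp add: affine_hull_2) (metis diff_add_cancel)
qed

lemma affine_line_turn:
  assumes "affine L" "aff_dim L = 1" "a \<in> L" "b \<in> L" "c \<in> L" "a \<noteq> b"
  shows "turn a b c = 0"
proof -
  have "affine hull {a, b} = L"
    by (rule affine_dim_equal) (use assms in \<open>auto simp: aff_dim_2 hull_minimal\<close>)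
  then obtain u v where "c = u *\<^sub>R a + v *\<^sub>R b" "u + v = 1"
    using assms(5) by (auto simp: affine_hull_2)
  hence c: "c = u *\<^sub>R a + (1 - u) *\<^sub>R b" by (metis add_diff_cancel_left')
  show ?thesis unfolding turn_def c by (simp add: algebra_simps)
qed

lemma at_most_on_line_imp:
  assumes "at_most_on_line s P" "finite P" "a \<noteq> b"
  shows "card (line_of P a b) \<le> s"
proof -
  have "card (P \<inter> affine hull {a, b}) \<le> s"
    using assms unfolding at_most_on_line_def by (simp add: aff_dim_2)
  moreover have "line_of P a b \<subseteq> P \<inter> affine hull {a, b}"
    using turn_in_affine_hull[OF assms(3)] unfolding line_of_def by blast
  hence "card (line_of P a b) \<le> card (P \<inter> affine hull {a, b})"
    using assms(2) by (intro card_mono) auto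
  ultimately show ?thesis by linarith
qed

text \<open>A line through two points of \<open>P\<close> is covered by a \<open>line_of\<close>;
  any other contains at most one point, whence \<open>1 \<le> s\<close>.\<close>

lemma at_most_on_lineI:
  assumes "finite P" "1 \<le> s" "\<And>a b. a \<in> P \<Longrightarrow> b \<in> P \<Longrightarrow> a \<noteq> b \<Longrightarrow> card (line_of P a b) \<le> s"
  shows "at_most_on_line s P"
  unfolding at_most_on_line_def
proof (intro allI impI)
  fix L :: "point set" assume L: "affine L \<and> aff_dim L = 1"
  show "card (P \<inter> L) \<le> s"
  proof (cases "\<exists>a\<in>P \<inter> L. \<exists>b\<in>P \<inter> L. a \<noteq> b")
    case True
    then obtain a b where ab: "a \<in> P \<inter> L" "b \<in> P \<inter> L" "a \<noteq> b" by blast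
    have "P \<inter> L \<subseteq> line_of P a b"
      using affine_line_turn[of L a b] L ab unfolding line_of_def by blast
    hence "card (P \<inter> L) \<le> card (line_of P a b)" by (intro card_mono finite_line_of assms(1))
    thus ?thesis using assms(3)[of a b] ab by simp
  next
    case False
    hence "card (P \<inter> L) \<le> 1"
      by (metis card_le_Suc0_iff_eq One_nat_def assms(1) finite_Int)
    thus ?thesis using assms(2) by simp
  qed
qed

text \<open>Two different parallel pairs with a common point lie on one line, so the quadruple comes
  from \<open>triples P\<close> in one of four arrangements. These quadruples survive with the
  larger probability \<open>1 / r ^ 2\<close> and are counted separately.\<close>

lemma quads_repeated_point:
  assumes "(a, b, c, d) \<in> parallel_quads P" "{a, b} \<noteq> {c, d}" "card {a, b, c, d} \<noteq> 4"
  shows "card {a, b, c, d} = 3 \<and> (\<exists>x. (a, b, x) \<in> triples P \<and>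
    ((c, d) = (a, x) \<or> (c, d) = (b, x) \<or> (c, d) = (x, a) \<or> (c, d) = (x, b)))"
proof -
  have q: "a \<in> P" "b \<in> P" "c \<in> P" "d \<in> P" "a \<noteq> b" "c \<noteq> d" "parallel a b c d"
    using assms(1) by (simp_all add: parallel_quads_def)
  have d_line: "turn a b d = 0" if "c = a \<or> c = b"
    using that q(7) unfolding parallel_def turn_def by (elim disjE) (simp_all add: algebra_simps)
  have c_line: "turn a b c = 0" if "d = a \<or> d = b"
    using that q(7) unfolding parallel_def turn_def by (elim disjE) (simp_all add: algebra_simps)
  have triple: "(a, b, x) \<in> triples P" if "x \<in> P" "turn a b x = 0" for x
    using that q by (simp add: triples_def line_of_def)
  show ?thesis
  proof (cases "c = a \<or> c = b")
    case True
    hence "d \<noteq> a" "d \<noteq> b" using q(6) assms(2) by auto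
    hence "card {a, b, c, d} = 3" using True q(5) by (auto simp: card_insert_if)
    thus ?thesis using True triple[OF q(4) d_line[OF True]] by blast
  next
    case c: False
    have d: "d = a \<or> d = b"
    proof (rule ccontr)
      assume "\<not> (d = a \<or> d = b)"
      hence "a \<noteq> c" "b \<noteq> c" "a \<noteq> d" "b \<noteq> d" using c by blast+
      thus False using assms(3) q(5,6) by simp
    qed
    hence "card {a, b, c, d} = 3" using c q(5) by (auto simp: card_insert_if)
    thus ?thesis using d triple[OF q(3) c_line[OF d]] by blast
  qed
qed

text \<open>Apply \<open>deletion\<close> to the point sets of all parallel quadruples in
  \<open>I\<close>. At most \<open>2 * n * T\<close> of them have four distinct points and weigh
  \<open>1 / r ^ 3\<close> each; at most \<open>4 * T\<close> have three and weigh
  \<open>1 / r ^ 2\<close> each.\<close>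

lemma exists_distinct_slopes:
  fixes s r :: nat and D :: real
  assumes P: "finite P" "at_most_on_line s P" and s: "2 \<le> s" "(real s)\<^sup>2 \<le> D * real (card P)" "0 \<le> D"
    and r: "0 < r" "r \<le> card P" "144 * (2304 + 12 * D) * (real (card P))\<^sup>2 * ln (real s) \<le> real r ^ 3"
  shows "\<exists>Q\<subseteq>P. card P \<le> 2 * r * card Q \<and> distinct_slopes Q"
proof -
  define n where "n = real (card P)"
  define T where "T = real (card (triples P))"
  have "T \<le> real (\<Sum>l\<in>lines P. card l ^ 3)"
    unfolding T_def using card_triples_le[OF P(1)] by (simp only: of_nat_le_iff)
  also have "\<dots> = (\<Sum>l\<in>lines P. real (card l) ^ 3)" by simp
  also have "\<dots> \<le> 9 * (2304 + 12 * D) * (real (card P))\<^sup>2 * ln (real s)"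
  proof (rule sum_cubes_lines_le[OF P(1) s])
    fix l assume "l \<in> lines P"
    then obtain a b where "a \<noteq> b" "l = line_of P a b" unfolding lines_def by blast
    thus "card l \<le> s" using at_most_on_line_imp[OF P(2,1)] by simp
  qed
  \<comment> \<open>In \<open>144 = 16 * 9\<close> the 9 comes from the sum of cubes; the 16 leaves
    room for both kinds of quadruples.\<close>
  finally have T: "16 * T \<le> real r ^ 3" using r(3) by linarith
  \<comment> \<open>Every pair is parallel to itself, so only different unordered pairs are
    forbidden.\<close>
  define I where "I = {q \<in> parallel_quads P. {fst q, fst (snd q)} \<noteq> {fst (snd (snd q)), snd (snd (snd q))}}"
  define S :: "point \<times> point \<times> point \<times> point \<Rightarrow> point set"
    where "S q = {fst q, fst (snd q), fst (snd (snd q)), snd (snd (snd q))}" for q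
  have finq: "finite (parallel_quads P)"
    by (rule finite_subset[of _ "P \<times> P \<times> P \<times> P"]) (use P(1) in \<open>auto simp: parallel_quads_def\<close>)
  hence finI: "finite I" by (simp add: I_def)
  have fint: "finite (triples P)"
    by (rule finite_subset[of _ "P \<times> P \<times> P"]) (use P(1) in \<open>auto simp: triples_def line_of_def\<close>)
  define I3 where "I3 = {q \<in> I. card (S q) \<noteq> 4}"
  have I3: "card (S q) = 3" "q \<in> (\<lambda>(a, b, x). (a, b, a, x)) ` triples P \<union> (\<lambda>(a, b, x). (a, b, b, x)) ` triples P
      \<union> (\<lambda>(a, b, x). (a, b, x, a)) ` triples P \<union> (\<lambda>(a, b, x). (a, b, x, b)) ` triples P" if q: "q \<in> I3" for q
  proof -
    obtain a b c d where e: "q = (a, b, c, d)" by (metis prod_cases4)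
    have *: "(a, b, c, d) \<in> parallel_quads P" "{a, b} \<noteq> {c, d}" "card {a, b, c, d} \<noteq> 4"
      using q by (simp_all add: e I3_def I_def S_def)
    note ** = quads_repeated_point[OF *]
    show "card (S q) = 3" using ** by (simp add: e S_def)
    from ** obtain x where x: "(a, b, x) \<in> triples P"
      "(c, d) = (a, x) \<or> (c, d) = (b, x) \<or> (c, d) = (x, a) \<or> (c, d) = (x, b)" by blast
    from x(2) show "q \<in> (\<lambda>(a, b, x). (a, b, a, x)) ` triples P \<union> (\<lambda>(a, b, x). (a, b, b, x)) ` triples P
      \<union> (\<lambda>(a, b, x). (a, b, x, a)) ` triples P \<union> (\<lambda>(a, b, x). (a, b, x, b)) ` triples P"
      using x(1) by (elim disjE) (force simp: e)+
  qed
  have "card I3 \<le> card ((\<lambda>(a, b, x). (a, b, a, x)) ` triples P \<union> (\<lambda>(a, b, x). (a, b, b, x)) ` triples P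
      \<union> (\<lambda>(a, b, x). (a, b, x, a)) ` triples P \<union> (\<lambda>(a, b, x). (a, b, x, b)) ` triples P)"
    using I3(2) fint by (intro card_mono subsetI) simp_all
  also have "\<dots> \<le> card (triples P) + card (triples P) + card (triples P) + card (triples P)"
    using fint by (intro order_trans[OF card_Un_le] add_mono card_image_le)
  finally have cI3: "real (card I3) \<le> 4 * T" by (simp add: T_def)
  have "card (I - I3) \<le> card (parallel_quads P)"
    by (rule card_mono[OF finq]) (auto simp: I_def)
  also have "\<dots> \<le> 2 * card P * card (triples P)" by (rule card_parallel_quads[OF P(1)])
  finally have "real (card (I - I3)) \<le> real (2 * card P * card (triples P))" by (simp only: of_nat_le_iff)
  hence cI4: "real (card (I - I3)) \<le> 2 * n * T" by (simp add: n_def T_def)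
  have "(\<Sum>q\<in>I. 1 / real r ^ (card (S q) - 1))
      = (\<Sum>q\<in>I - I3. 1 / real r ^ (card (S q) - 1)) + (\<Sum>q\<in>I3. 1 / real r ^ (card (S q) - 1))"
    using finI by (intro sum.subset_diff) (auto simp: I3_def)
  also have "(\<Sum>q\<in>I3. 1 / real r ^ (card (S q) - 1)) = (\<Sum>q\<in>I3. 1 / (real r)\<^sup>2)"
    using I3(1) by (intro sum.cong) simp_all
  also have "(\<Sum>q\<in>I - I3. 1 / real r ^ (card (S q) - 1)) = (\<Sum>q\<in>I - I3. 1 / real r ^ 3)"
    by (intro sum.cong) (simp_all add: I3_def)
  also have "(\<Sum>q\<in>I - I3. 1 / real r ^ 3) + (\<Sum>q\<in>I3. 1 / (real r)\<^sup>2)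
      = real (card (I - I3)) / real r ^ 3 + real (card I3) / (real r)\<^sup>2" by simp
  also have "\<dots> \<le> 2 * n * T / real r ^ 3 + 4 * T / (real r)\<^sup>2"
    by (intro add_mono divide_right_mono cI3 cI4) simp_all
  \<comment> \<open>The total stays below the \<open>n / 2\<close> allowed by
    \<open>deletion\<close>; the second summand relies on \<open>r \<le> n\<close>.\<close>
  also have "\<dots> \<le> n / 8 + n / 4"
  proof (rule add_mono)
    have rp: "real r > 0" using r(1) by simp
    have n0: "n \<ge> 0" by (simp add: n_def)
    have "2 * n * T = n / 8 * (16 * T)" by simp
    also have "\<dots> \<le> n / 8 * real r ^ 3" using T n0 by (intro mult_left_mono) auto
    finally show "2 * n * T / real r ^ 3 \<le> n / 8" using rp by (simp add: divide_le_eq)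
    have "4 * T \<le> real r / 4 * (real r)\<^sup>2" using T by (simp add: power2_eq_square power3_eq_cube)
    also have "\<dots> \<le> n / 4 * (real r)\<^sup>2" using r(2) by (intro mult_right_mono) (simp_all add: n_def)
    finally show "4 * T / (real r)\<^sup>2 \<le> n / 4" using rp by (simp add: divide_le_eq)
  qed
  also have "\<dots> \<le> real (card P) / 2" by (simp add: n_def)
  finally have few: "(\<Sum>q\<in>I. 1 / real r ^ (card (S q) - 1)) \<le> real (card P) / 2" .
  have SP: "S q \<subseteq> P" if "q \<in> I" for q
    using that by (auto simp: I_def S_def parallel_quads_def)
  obtain Q where Q: "Q \<subseteq> P" "card P \<le> 2 * r * card Q" "\<forall>q\<in>I. \<not> S q \<subseteq> Q"
    using deletion[OF P(1) finI SP _ r(1) few] by (auto simp: S_def)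
  have "distinct_slopes Q"
    unfolding distinct_slopes_def
  proof (intro ballI impI notI)
    fix a b c d assume q: "a \<in> Q" "b \<in> Q" "c \<in> Q" "d \<in> Q" "a \<noteq> b" "c \<noteq> d" "{a, b} \<noteq> {c, d}"
      "slope a b = slope c d"
    hence "parallel a b c d" by (intro slope_eq_imp_parallel)
    hence "(a, b, c, d) \<in> I" using q Q(1) by (auto simp: I_def parallel_quads_def)
    moreover have "S (a, b, c, d) \<subseteq> Q" using q by (simp add: S_def)
    ultimately show False using Q(3) by blast
  qed
  thus ?thesis using Q by blast
qed

section \<open>Points on a parabola\<close>

lemma distinct_slopes_empty [simp]: "distinct_slopes {}"
  by (simp add: distinct_slopes_def)

lemma distinct_slopes_subset: "distinct_slopes Q \<Longrightarrow> Q' \<subseteq> Q \<Longrightarrow> distinct_slopes Q'"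
  unfolding distinct_slopes_def by blast

lemma distinct_slopesD:
  assumes "distinct_slopes Q" "a \<in> Q" "b \<in> Q" "c \<in> Q" "d \<in> Q" "a \<noteq> b" "c \<noteq> d" "slope a b = slope c d"
  shows "a = c \<and> b = d \<or> a = d \<and> b = c"
proof -
  have "{a, b} = {c, d}" using assms unfolding distinct_slopes_def by blast
  thus ?thesis by (simp add: doubleton_eq_iff)
qed

text \<open>The maximum defining \<open>h\<close> is attained: 0 is admissible, and the given
  \<open>P\<close> bounds every admissible value by \<open>n\<close>. So a single configuration
  bounds \<open>h\<close> from above.\<close>

lemma h_le:
  assumes P: "finite P" "card P = n" "at_most_on_line s P"
    and le: "\<And>Q. Q \<subseteq> P \<Longrightarrow> distinct_slopes Q \<Longrightarrow> real (card Q) \<le> m"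
  shows "real (h n s) \<le> m"
proof -
  let ?R = "\<lambda>k. \<forall>P. finite P \<and> card P = n \<and> at_most_on_line s P \<longrightarrow> (\<exists>Q\<subseteq>P. card Q = k \<and> distinct_slopes Q)"
  have "?R (h n s)" unfolding h_def
  proof (rule GreatestI_nat[of ?R 0])
    show "?R 0" by (metis card.empty distinct_slopes_empty empty_subsetI)
    show "k \<le> card P" if "?R k" for k using that P by (metis card_mono)
  qed
  then obtain Q where "Q \<subseteq> P" "card Q = h n s" "distinct_slopes Q" using P by blast
  thus ?thesis using le[of Q] by simp
qed

definition parabola :: "nat \<Rightarrow> point set" where
  "parabola n = (\<lambda>i. (real i, (real i)\<^sup>2)) ` {..<n}"

lemma card_parabola: "card (parabola n) = n" "finite (parabola n)"
  unfolding parabola_def by (subst card_image) (auto intro: inj_onI)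

lemma at_most_on_line_parabola:
  assumes "2 \<le> s"
  shows "at_most_on_line s (parabola n)"
proof (rule at_most_on_lineI)
  fix a b assume ab: "a \<in> parabola n" "b \<in> parabola n" "a \<noteq> b"
  have sq: "snd p = (fst p)\<^sup>2" if "p \<in> parabola n" for p using that by (auto simp: parabola_def)
  have "line_of (parabola n) a b \<subseteq> {a, b}"
  proof
    fix c assume c: "c \<in> line_of (parabola n) a b"
    hence c': "c \<in> parabola n" "turn a b c = 0" by (simp_all add: line_of_def)
    \<comment> \<open>On the parabola \<open>turn\<close> is a Vandermonde determinant and
      factors.\<close>
    have "(fst b - fst a) * ((fst c - fst a) * (fst c - fst b)) = turn a b c"
      unfolding turn_def sq[OF ab(1)] sq[OF ab(2)] sq[OF c'(1)] by (simp add: power2_eq_square algebra_simps)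
    moreover have "fst a \<noteq> fst b" using sq[OF ab(1)] sq[OF ab(2)] ab(3) by (auto simp: prod_eq_iff)
    ultimately have "fst c = fst a \<or> fst c = fst b" using c'(2) by simp
    thus "c \<in> {a, b}" using sq[OF ab(1)] sq[OF ab(2)] sq[OF c'(1)] by (auto simp: prod_eq_iff)
  qed
  hence "card (line_of (parabola n) a b) \<le> card {a, b}" by (intro card_mono) simp_all
  also have "\<dots> \<le> s" using assms ab(3) by simp
  finally show "card (line_of (parabola n) a b) \<le> s" .
qed (use assms card_parabola in auto)

lemma card_offdiagonal:
  assumes "finite Q"
  shows "real (card {p \<in> Q \<times> Q. fst p \<noteq> snd p}) = (real (card Q))\<^sup>2 - real (card Q)"
proof -
  have "{p \<in> Q \<times> Q. fst p \<noteq> snd p} = Q \<times> Q - (\<lambda>x. (x, x)) ` Q" by auto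
  moreover have "card ((\<lambda>x. (x, x)) ` Q) = card Q" by (intro card_image inj_onI) simp
  moreover have "card (Q \<times> Q - (\<lambda>x. (x, x)) ` Q) = card (Q \<times> Q) - card ((\<lambda>x. (x, x)) ` Q)"
    using assms by (intro card_Diff_subset) auto
  ultimately have "card {p \<in> Q \<times> Q. fst p \<noteq> snd p} = card Q * card Q - card Q"
    by (simp add: card_cartesian_product)
  moreover have "card Q \<le> card Q * card Q" by simp
  ultimately show ?thesis by (simp add: of_nat_diff power2_eq_square)
qed

text \<open>The slopes are sums \<open>i + j < 2 * n\<close>, and slope and orientation determine an
  ordered pair, so \<open>k\<close> points satisfy \<open>k * (k - 1) \<le> 4 * n\<close>.\<close>

lemma distinct_slopes_parabola:
  assumes "Q \<subseteq> parabola n" "distinct_slopes Q"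
  shows "real (card Q) \<le> 2 * sqrt (real n) + 1"
proof -
  have fin: "finite Q" using assms card_parabola finite_subset by blast
  let ?X = "{p \<in> Q \<times> Q. fst p \<noteq> snd p}"
  \<comment> \<open>The Boolean separates the two orders of a pair, whose slopes agree.\<close>
  let ?g = "\<lambda>p::point \<times> point. (fst (fst p) < fst (snd p), slope (fst p) (snd p))"
  have par: "\<exists>i<n. p = (real i, (real i)\<^sup>2)" if "p \<in> Q" for p
    using that assms(1) by (auto simp: parabola_def)
  have "card ?X \<le> card ((UNIV :: bool set) \<times> (\<lambda>k. ereal (real k)) ` {..<2 * n})"
  proof (rule card_inj_on_le[of ?g])
    show "inj_on ?g ?X"
    proof (rule inj_onI)
      fix p q assume p: "p \<in> ?X" and q: "q \<in> ?X" and eq: "?g p = ?g q"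
      have "fst p = fst q \<and> snd p = snd q \<or> fst p = snd q \<and> snd p = fst q"
        by (rule distinct_slopesD[OF assms(2)]) (use p q eq in auto)
      moreover have "\<not> (fst p = snd q \<and> snd p = fst q)"
      proof
        assume sw: "fst p = snd q \<and> snd p = fst q"
        have "fst p \<in> Q" "snd p \<in> Q" "fst p \<noteq> snd p" using p by (auto simp: mem_Times_iff)
        hence "fst (fst p) \<noteq> fst (snd p)" using par[of "fst p"] par[of "snd p"] by auto
        thus False using eq sw by auto
      qed
      ultimately show "p = q" by (blast intro: prod_eqI)
    qed
    show "?g ` ?X \<subseteq> UNIV \<times> (\<lambda>k. ereal (real k)) ` {..<2 * n}"
    proof
      fix y assume "y \<in> ?g ` ?X"
      then obtain p where p: "p \<in> ?X" "y = ?g p" by blast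
      obtain i j where ij: "i < n" "j < n" "fst p = (real i, (real i)\<^sup>2)" "snd p = (real j, (real j)\<^sup>2)"
        using par[of "fst p"] par[of "snd p"] p(1) by (auto simp: mem_Times_iff)
      have ne: "i \<noteq> j" using ij p(1) by auto
      have "((real j)\<^sup>2 - (real i)\<^sup>2) / (real j - real i) = real (i + j)"
        using ne by (simp add: power2_eq_square field_simps)
      hence "slope (fst p) (snd p) = ereal (real (i + j))"
        using ne by (simp add: slope_def ij)
      moreover have "i + j < 2 * n" using ij by simp
      ultimately show "y \<in> UNIV \<times> (\<lambda>k. ereal (real k)) ` {..<2 * n}"
        unfolding p(2) by blast
    qed
  qed simp
  also have "\<dots> \<le> 2 * (2 * n)"
    using card_image_le[of "{..<2 * n}" "\<lambda>k. ereal (real k)"] by (simp add: card_cartesian_product)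
  finally have "real (card ?X) \<le> 4 * real n" by linarith
  hence "(real (card Q))\<^sup>2 - real (card Q) \<le> 4 * real n" using card_offdiagonal[OF fin] by simp
  hence "real (card Q) - 1 \<le> sqrt (4 * real n)"
  proof (cases "card Q = 0")
    case False
    hence "(real (card Q) - 1)\<^sup>2 \<le> (real (card Q))\<^sup>2 - real (card Q)"
      by (simp add: power2_eq_square algebra_simps)
    thus ?thesis using \<open>(real (card Q))\<^sup>2 - real (card Q) \<le> 4 * real n\<close>
      by (intro real_le_rsqrt) linarith
  qed (use real_sqrt_ge_zero[of "4 * real n"] in linarith)
  thus ?thesis by (simp add: real_sqrt_mult)
qed

lemma h_le_sqrt: "2 \<le> s \<Longrightarrow> real (h n s) \<le> 2 * sqrt (real n) + 1"
  by (rule h_le[OF card_parabola(2,1) at_most_on_line_parabola distinct_slopes_parabola])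

text \<open>Larger sets are cut down to exactly \<open>k\<close> points. The parabola shows that
  admissible values are at most \<open>n\<close>, so the greatest one exists.\<close>

lemma h_ge:
  assumes "2 \<le> s"
    and ex: "\<And>P. finite P \<Longrightarrow> card P = n \<Longrightarrow> at_most_on_line s P \<Longrightarrow> \<exists>Q\<subseteq>P. k \<le> card Q \<and> distinct_slopes Q"
  shows "k \<le> h n s"
  unfolding h_def
proof (rule Greatest_le_nat[where b = n])
  show "\<forall>P. finite P \<and> card P = n \<and> at_most_on_line s P \<longrightarrow> (\<exists>Q\<subseteq>P. card Q = k \<and> distinct_slopes Q)"
  proof (intro allI impI)
    fix P assume "finite P \<and> card P = n \<and> at_most_on_line s P"
    then obtain Q where "Q \<subseteq> P" "k \<le> card Q" "distinct_slopes Q" using ex by blast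
    thus "\<exists>Q\<subseteq>P. card Q = k \<and> distinct_slopes Q"
      by (metis distinct_slopes_subset obtain_subset_with_card_n subset_trans)
  qed
  fix j assume "\<forall>P. finite P \<and> card P = n \<and> at_most_on_line s P \<longrightarrow> (\<exists>Q\<subseteq>P. card Q = j \<and> distinct_slopes Q)"
  then obtain Q where "Q \<subseteq> parabola n" "card Q = j"
    using card_parabola at_most_on_line_parabola[OF assms(1)] by blast
  thus "j \<le> n" using card_mono[OF card_parabola(2)] card_parabola(1) by metis
qed

section \<open>Distinct slopes in a grid\<close>

text \<open>Cauchy-Schwarz over the fibres of \<open>\<phi>\<close>; the collisions include the
  diagonal.\<close>

lemma card_squared_le_collisions:
  assumes "finite A" "finite C" "\<phi> ` A \<subseteq> C"
  shows "(real (card A))\<^sup>2 \<le> real (card C) * real (card {p \<in> A \<times> A. \<phi> (fst p) = \<phi> (snd p)})"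
proof -
  define N where "N c = {a \<in> A. \<phi> a = c}" for c
  have "card A = (\<Sum>c\<in>C. card (N c))"
    using sum.group[OF assms(1,2,3), of "\<lambda>_. 1::nat"] by (simp add: N_def)
  hence "(real (card A))\<^sup>2 = (\<Sum>c\<in>C. real (card (N c)))\<^sup>2" by simp
  also have "\<dots> \<le> (\<Sum>c\<in>C. (real (card (N c)))\<^sup>2) * real (card C)"
    by (rule sum_squared_le_sum_of_squares)
  also have "(\<Sum>c\<in>C. (real (card (N c)))\<^sup>2) = real (\<Sum>c\<in>C. card (N c \<times> N c))"
    by (simp add: card_cartesian_product power2_eq_square)
  also have "(\<Sum>c\<in>C. card (N c \<times> N c)) = card (\<Union>c\<in>C. N c \<times> N c)"
    using assms by (intro card_UN_disjoint[symmetric]) (auto simp: N_def)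
  also have "(\<Union>c\<in>C. N c \<times> N c) = {p \<in> A \<times> A. \<phi> (fst p) = \<phi> (snd p)}"
    using assms(3) by (auto simp: N_def)
  finally show ?thesis by (simp add: mult.commute)
qed

section \<open>Integer difference vectors and cells of a grid\<close>

definition emb :: "nat \<times> nat \<Rightarrow> point" where
  "emb u = (real (fst u), real (snd u))"

lemma fst_emb [simp]: "fst (emb u) = real (fst u)" and snd_emb [simp]: "snd (emb u) = real (snd u)"
  by (simp_all add: emb_def)

lemma inj_emb: "inj emb"
  by (intro injI) (simp add: emb_def prod_eq_iff)

definition delta :: "(nat \<times> nat) \<times> (nat \<times> nat) \<Rightarrow> int \<times> int" where
  "delta p = (int (fst (fst p)) - int (fst (snd p)), int (snd (fst p)) - int (snd (snd p)))"

text \<open>The factor \<open>q\<close> cancels, so the slope depends on the reduced vector alone.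
  This makes pairs for different \<open>q\<close> comparable.\<close>

lemma slope_emb:
  assumes "delta (u, v) = (int q * w1, int q * w2)" "q > 0"
  shows "slope (emb u) (emb v) = (if w1 = 0 then \<infinity> else ereal (real_of_int w2 / real_of_int w1))"
proof -
  have d: "real (fst v) - real (fst u) = - (real q * real_of_int w1)"
    "real (snd v) - real (snd u) = - (real q * real_of_int w2)"
    using assms(1) by (auto simp: delta_def) (metis minus_diff_eq of_int_diff of_int_mult of_int_of_nat_eq)+
  have "real (fst u) = real (fst v) \<longleftrightarrow> w1 = 0" using d(1) assms(2) by auto
  moreover have "(real (snd v) - real (snd u)) / (real (fst v) - real (fst u)) = real_of_int w2 / real_of_int w1"
    unfolding d using assms(2) by simp
  ultimately show ?thesis by (simp add: slope_def)
qed

text \<open>Equal residues make the difference a multiple of \<open>q\<close>, and a common block of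
  length \<open>q * m\<close> bounds it.\<close>

lemma same_cell_diff:
  fixes x y q m :: nat
  assumes "x mod q = y mod q" "x div (q * m) = y div (q * m)" "q > 0" "m > 0"
  shows "\<exists>w. int x - int y = int q * w \<and> \<bar>w\<bar> < int m"
proof -
  have "int q dvd int x - int y"
    using assms(1) by (metis mod_eq_dvd_iff zmod_int)
  then obtain w where w: "int x - int y = int q * w" by (auto simp: dvd_def)
  let ?d = "q * m"
  have "x = ?d * (x div ?d) + x mod ?d" "y = ?d * (x div ?d) + y mod ?d"
    using assms(2) by (metis mult_div_mod_eq)+
  moreover have "x mod ?d < ?d" "y mod ?d < ?d" using assms by simp_all
  ultimately have "\<bar>int x - int y\<bar> < int ?d" by linarith
  hence "int q * \<bar>w\<bar> < int q * int m" unfolding w by (simp add: abs_mult)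
  hence "\<bar>w\<bar> < int m" using assms(3) by simp
  thus ?thesis using w by blast
qed

text \<open>For each \<open>q\<close> up to \<open>N div m\<close>, Cauchy-Schwarz yields many pairs
  in a common cell; the subtracted \<open>card A\<close> is the diagonal. All these pairs, tagged by
  \<open>q\<close>, inject into the reduced vectors with coordinates below \<open>m\<close> in
  absolute value.\<close>

lemma grid_pairs_ineq:
  fixes N m :: nat
  assumes A: "A \<subseteq> {..<N} \<times> {..<N}" and ds: "distinct_slopes (emb ` A)" and m: "0 < m"
  shows "real (N div m) * ((real (card A))\<^sup>2 * (real m)\<^sup>2 / (4 * (real N)\<^sup>2) - real (card A)) \<le> 4 * (real m)\<^sup>2"
proof -
  have fin: "finite A" using A finite_subset by blast
  define Q where "Q = N div m"
  define cell where "cell q u = ((fst u mod q, fst u div (q * m)), (snd u mod q, snd u div (q * m)))"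
    for q :: nat and u :: "nat \<times> nat"
  define X where "X q = {p \<in> A \<times> A. fst p \<noteq> snd p \<and> cell q (fst p) = cell q (snd p)}" for q
  have finX: "finite (X q)" for q using fin by (simp add: X_def)
  have lower: "(real (card A))\<^sup>2 * (real m)\<^sup>2 / (4 * (real N)\<^sup>2) - real (card A) \<le> real (card (X q))"
    if q: "q \<in> {1..Q}" for q
  proof -
    \<comment> \<open>Cells along one axis: a residue and a block. Since
      \<open>q * m \<le> N\<close>, there are at most \<open>2 * N / m\<close> of them despite
      rounding.\<close>
    define K where "K = {..<q} \<times> {..<N div (q * m) + 1}"
    have qm: "q * m \<le> N" using q unfolding Q_def
      by (metis atLeastAtMost_iff div_times_less_eq_dividend mult_le_mono1 order_trans)
    hence Npos: "N > 0" using q m by (metis atLeastAtMost_iff gr0I le_zero_eq mult_is_0 not_one_le_zero less_irrefl)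
    have img: "cell q ` A \<subseteq> K \<times> K"
    proof
      fix y assume "y \<in> cell q ` A"
      then obtain u where u: "u \<in> A" "y = cell q u" by blast
      hence "fst u < N" "snd u < N" using A by (auto simp: mem_Times_iff)
      hence "fst u div (q * m) \<le> N div (q * m)" "snd u div (q * m) \<le> N div (q * m)"
        by (simp_all add: div_le_mono)
      thus "y \<in> K \<times> K" using q by (simp add: u(2) cell_def K_def)
    qed
    have "card (K \<times> K) = (q * (N div (q * m) + 1))\<^sup>2"
      by (simp add: K_def card_cartesian_product power2_eq_square)
    hence cK: "real (card (K \<times> K)) = (real (q * (N div (q * m) + 1)))\<^sup>2" by simp
    have "m * (q * (N div (q * m) + 1)) = (q * m) * (N div (q * m)) + q * m" by (simp add: algebra_simps)
    also have "\<dots> \<le> N + N" using qm by (intro add_mono times_div_less_eq_dividend)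
    finally have "real (m * (q * (N div (q * m) + 1))) \<le> real (N + N)" by (simp only: of_nat_le_iff)
    hence "real m * real (q * (N div (q * m) + 1)) \<le> 2 * real N" by simp
    hence "(real m * real (q * (N div (q * m) + 1)))\<^sup>2 \<le> (2 * real N)\<^sup>2" by (intro power_mono) auto
    hence mK: "(real m)\<^sup>2 * real (card (K \<times> K)) \<le> 4 * (real N)\<^sup>2"
      unfolding cK by (simp add: power_mult_distrib)
    let ?Y = "{p \<in> A \<times> A. cell q (fst p) = cell q (snd p)}"
    have "(real (card A))\<^sup>2 * (real m)\<^sup>2 \<le> real (card (K \<times> K)) * real (card ?Y) * (real m)\<^sup>2"
      using card_squared_le_collisions[OF fin _ img] by (intro mult_right_mono) (simp_all add: K_def)
    also have "\<dots> = (real m)\<^sup>2 * real (card (K \<times> K)) * real (card ?Y)" by (simp only: ac_simps)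
    also have "\<dots> \<le> 4 * (real N)\<^sup>2 * real (card ?Y)" using mK by (intro mult_right_mono) auto
    finally have "(real (card A))\<^sup>2 * (real m)\<^sup>2 / (4 * (real N)\<^sup>2) \<le> real (card ?Y)"
      using Npos by (simp add: divide_le_eq mult.commute)
    moreover have "?Y \<subseteq> X q \<union> (\<lambda>u. (u, u)) ` A" by (force simp: X_def)
    hence "card ?Y \<le> card (X q \<union> (\<lambda>u. (u, u)) ` A)" using finX fin by (intro card_mono) auto
    also have "\<dots> \<le> card (X q) + card A"
      using card_Un_le[of "X q" "(\<lambda>u. (u, u)) ` A"] card_image_le[OF fin, of "\<lambda>u. (u, u)"] by linarith
    ultimately show ?thesis by linarith
  qed
  have diff: "\<exists>w1 w2. delta p = (int q * w1, int q * w2) \<and> \<bar>w1\<bar> < int m \<and> \<bar>w2\<bar> < int m"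
    if "q \<in> {1..Q}" "p \<in> X q" for q p
  proof -
    have c: "fst (fst p) mod q = fst (snd p) mod q" "fst (fst p) div (q * m) = fst (snd p) div (q * m)"
      "snd (fst p) mod q = snd (snd p) mod q" "snd (fst p) div (q * m) = snd (snd p) div (q * m)"
      using that(2) by (simp_all add: X_def cell_def)
    show ?thesis
      using same_cell_diff[OF c(1,2) _ m] same_cell_diff[OF c(3,4) _ m] that(1) by (auto simp: delta_def)
  qed
  \<comment> \<open>The divisions are exact for pairs in \<open>X q\<close>, so \<open>g\<close>
    returns the reduced vector.\<close>
  define g where "g z = (fst (delta (snd z)) div int (fst z), snd (delta (snd z)) div int (fst z))"
    for z :: "nat \<times> ((nat \<times> nat) \<times> (nat \<times> nat))"
  let ?W = "{- int m<..<int m}"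
  have "card (SIGMA q:{1..Q}. X q) \<le> card (?W \<times> ?W)"
  proof (rule card_inj_on_le[of g])
    have gz: "\<exists>w1 w2. delta p = (int q * w1, int q * w2) \<and> \<bar>w1\<bar> < int m \<and> \<bar>w2\<bar> < int m \<and> g (q, p) = (w1, w2)"
      if z: "q \<in> {1..Q}" "p \<in> X q" for q p
    proof -
      obtain w1 w2 where w: "delta p = (int q * w1, int q * w2)" "\<bar>w1\<bar> < int m" "\<bar>w2\<bar> < int m"
        using diff[OF z] by blast
      moreover have "g (q, p) = (w1, w2)" using z(1) by (simp add: g_def w(1))
      ultimately show ?thesis by blast
    qed
    show "inj_on g (SIGMA q:{1..Q}. X q)"
    proof (rule inj_onI)
      fix z z' assume z: "z \<in> (SIGMA q:{1..Q}. X q)" and z': "z' \<in> (SIGMA q:{1..Q}. X q)" and eq: "g z = g z'"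
      obtain q u v where e: "z = (q, (u, v))" by (metis surj_pair)
      obtain q' u' v' where e': "z' = (q', (u', v'))" by (metis surj_pair)
      have q: "q \<in> {1..Q}" "(u, v) \<in> X q" "q' \<in> {1..Q}" "(u', v') \<in> X q'" using z z' e e' by auto
      obtain w1 w2 where w: "delta (u, v) = (int q * w1, int q * w2)" "g (q, (u, v)) = (w1, w2)"
        using gz[OF q(1,2)] by blast
      obtain w1' w2' where w': "delta (u', v') = (int q' * w1', int q' * w2')" "g (q', (u', v')) = (w1', w2')"
        using gz[OF q(3,4)] by blast
      have ww: "w1' = w1" "w2' = w2" using eq w(2) w'(2) e e' by simp_all
      have mem: "u \<in> A" "v \<in> A" "u \<noteq> v" "u' \<in> A" "v' \<in> A" "u' \<noteq> v'" using q by (simp_all add: X_def)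
      \<comment> \<open>Equal reduced vectors give equal slopes, so the unordered pairs agree; as
        the vector is nonzero, it then recovers \<open>q\<close> and excludes a reversal.\<close>
      have "slope (emb u) (emb v) = slope (emb u') (emb v')"
        using slope_emb[OF w(1)] slope_emb[OF w'(1)] q(1,3) ww by simp
      hence "emb u = emb u' \<and> emb v = emb v' \<or> emb u = emb v' \<and> emb v = emb u'"
        using mem by (intro distinct_slopesD[OF ds]) (auto simp: inj_eq[OF inj_emb])
      hence cases: "u = u' \<and> v = v' \<or> u = v' \<and> v = u'" by (simp add: inj_eq[OF inj_emb])
      have nz: "w1 \<noteq> 0 \<or> w2 \<noteq> 0"
        using w(1) mem(3) by (auto simp: delta_def prod_eq_iff)
      from cases show "z = z'"
      proof
        assume "u = u' \<and> v = v'"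
        moreover from this have "int q * w1 = int q' * w1" "int q * w2 = int q' * w2"
          using w(1) w'(1) ww by auto
        hence "q = q'" using nz by auto
        ultimately show ?thesis using e e' by simp
      next
        assume "u = v' \<and> v = u'"
        hence "int q * w1 = - (int q' * w1)" "int q * w2 = - (int q' * w2)"
          using w(1) w'(1) ww by (auto simp: delta_def)
        hence "(int q + int q') * w1 = 0" "(int q + int q') * w2 = 0" by (simp_all add: distrib_right)
        thus ?thesis using nz q(1) by auto
      qed
    qed
    show "g ` (SIGMA q:{1..Q}. X q) \<subseteq> ?W \<times> ?W"
    proof
      fix y assume "y \<in> g ` (SIGMA q:{1..Q}. X q)"
      then obtain q p where z: "q \<in> {1..Q}" "p \<in> X q" "y = g (q, p)" by blast
      show "y \<in> ?W \<times> ?W" using gz[OF z(1,2)] unfolding z(3) by (auto simp: abs_less_iff)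
    qed
  qed simp
  also have "\<dots> = (2 * m - 1)\<^sup>2" using m by (simp add: card_cartesian_product power2_eq_square nat_diff_distrib' nat_mult_distrib)
  also have "\<dots> \<le> (2 * m)\<^sup>2" by (intro power_mono) auto
  finally have "card (SIGMA q:{1..Q}. X q) \<le> 4 * m\<^sup>2" by (simp add: power_mult_distrib)
  hence "(\<Sum>q\<in>{1..Q}. card (X q)) \<le> 4 * m\<^sup>2" using finX by (simp add: card_SigmaI)
  hence "real (\<Sum>q\<in>{1..Q}. card (X q)) \<le> real (4 * m\<^sup>2)" by (simp only: of_nat_le_iff)
  hence "(\<Sum>q\<in>{1..Q}. real (card (X q))) \<le> 4 * (real m)\<^sup>2" by simp
  moreover have "(\<Sum>q\<in>{1..Q}. (real (card A))\<^sup>2 * (real m)\<^sup>2 / (4 * (real N)\<^sup>2) - real (card A))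
      \<le> (\<Sum>q\<in>{1..Q}. real (card (X q)))"
    by (intro sum_mono lower)
  ultimately show ?thesis by (simp add: Q_def)
qed

text \<open>With \<open>z = N powr (1/5)\<close>, the choice of \<open>m\<close> near
  \<open>z ^ 3\<close> balances the bounds \<open>N ^ 2 / m ^ 2\<close> and
  \<open>sqrt (N * m)\<close> of the two cases at order \<open>z ^ 4\<close>.\<close>

lemma grid_distinct_slopes:
  assumes A: "A \<subseteq> {..<N} \<times> {..<N}" and ds: "distinct_slopes (emb ` A)" and N: "N \<ge> 1"
  shows "real (card A) \<le> 12 * real N powr (4/5)"
proof -
  define z where "z = real N powr (1/5)"
  have z1: "z \<ge> 1" using N by (simp add: z_def ge_one_powr_ge_zero)
  have zN: "z ^ 5 = real N" using N by (simp add: z_def powr_power)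
  have z4: "real N powr (4/5) = z ^ 4" using N by (simp add: z_def powr_power)
  define m where "m = nat \<lceil>z ^ 3\<rceil>"
  have z3: "z ^ 3 \<ge> 1" using z1 by (rule one_le_power)
  have m1: "z ^ 3 \<le> real m" unfolding m_def by (rule real_nat_ceiling_ge)
  have "real m < z ^ 3 + 1" using z3 unfolding m_def by linarith
  hence m2: "real m \<le> 2 * z ^ 3" using z3 by linarith
  have "0 < real m" using m1 z3 by linarith
  hence m0: "0 < m" by simp
  have "z ^ 3 \<le> z ^ 5" using z1 by (intro power_increasing) auto
  hence mN: "m \<le> N" using zN unfolding m_def by (simp add: ceiling_le_iff nat_le_iff)
  define k where "k = real (card A)"
  define Q where "Q = real (N div m)"
  have "N < (N div m + 1) * m" using m0 by (simp add: dividend_less_div_times)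
  moreover have "1 \<le> N div m" using mN m0 by (simp add: Suc_le_eq div_greater_zero_iff)
  hence "(N div m + 1) * m \<le> 2 * (N div m) * m" by (intro mult_right_mono) auto
  ultimately have "N \<le> 2 * (N div m) * m" by linarith
  hence Q: "real N \<le> 2 * Q * real m" unfolding Q_def by (metis of_nat_le_iff of_nat_mult of_nat_numeral)
  have ineq: "Q * (k\<^sup>2 * (real m)\<^sup>2 / (4 * (real N)\<^sup>2) - k) \<le> 4 * (real m)\<^sup>2"
    using grid_pairs_ineq[OF A ds m0] by (simp add: Q_def k_def)
  have Npos: "real N > 0" "real m > 0" using N m0 by simp_all
  show ?thesis
  proof (cases "k * (real m)\<^sup>2 < 8 * (real N)\<^sup>2")
    case True
    have "k * (z ^ 3)\<^sup>2 \<le> k * (real m)\<^sup>2"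
      using m1 z1 by (intro mult_left_mono power_mono) (simp_all add: k_def)
    also have "\<dots> \<le> 8 * (z ^ 5)\<^sup>2" using True zN by simp
    also have "\<dots> = 8 * z ^ 4 * (z ^ 3)\<^sup>2" by (simp add: mult.assoc flip: power_mult power_add)
    finally have "k * (z ^ 3)\<^sup>2 \<le> 8 * z ^ 4 * (z ^ 3)\<^sup>2" .
    hence "k \<le> 8 * z ^ 4" using z1 by simp
    also have "\<dots> \<le> 12 * z ^ 4" using z1 by simp
    finally show ?thesis by (simp add: z4 k_def)
  next
    case False
    have Q0: "Q \<ge> 0" by (simp add: Q_def)
    \<comment> \<open>In this case the diagonal term \<open>k\<close> is at most half of the main
      term.\<close>
    have "k * (8 * (real N)\<^sup>2) \<le> k * (k * (real m)\<^sup>2)" using False by (intro mult_left_mono) (simp_all add: k_def)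
    hence "k \<le> k\<^sup>2 * (real m)\<^sup>2 / (8 * (real N)\<^sup>2)" using Npos
      by (simp add: le_divide_eq power2_eq_square mult.assoc)
    hence "k\<^sup>2 * (real m)\<^sup>2 / (8 * (real N)\<^sup>2) \<le> k\<^sup>2 * (real m)\<^sup>2 / (4 * (real N)\<^sup>2) - k" by simp
    from mult_left_mono[OF this Q0] ineq
    have "Q * (k\<^sup>2 * (real m)\<^sup>2 / (8 * (real N)\<^sup>2)) \<le> 4 * (real m)\<^sup>2" by linarith
    hence "Q * (k\<^sup>2 * (real m)\<^sup>2 / (8 * (real N)\<^sup>2)) * (8 * (real N)\<^sup>2) \<le> 4 * (real m)\<^sup>2 * (8 * (real N)\<^sup>2)"
      by (rule mult_right_mono) simp
    also have "Q * (k\<^sup>2 * (real m)\<^sup>2 / (8 * (real N)\<^sup>2)) * (8 * (real N)\<^sup>2) = Q * k\<^sup>2 * (real m)\<^sup>2"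
      using Npos by simp
    also have "4 * (real m)\<^sup>2 * (8 * (real N)\<^sup>2) = 32 * (real N)\<^sup>2 * (real m)\<^sup>2" by simp
    finally have "Q * k\<^sup>2 * (real m)\<^sup>2 \<le> 32 * (real N)\<^sup>2 * (real m)\<^sup>2" .
    hence Qk: "Q * k\<^sup>2 \<le> 32 * (real N)\<^sup>2" using Npos by (simp only: mult_le_cancel_right) simp
    have "real N * k\<^sup>2 \<le> 2 * Q * real m * k\<^sup>2" using Q by (intro mult_right_mono) auto
    also have "\<dots> = 2 * real m * (Q * k\<^sup>2)" by simp
    also have "\<dots> \<le> 2 * real m * (32 * (real N)\<^sup>2)" using Qk by (intro mult_left_mono) auto
    also have "\<dots> = real N * (64 * real N * real m)" by (simp add: power2_eq_square)
    finally have "real N * k\<^sup>2 \<le> real N * (64 * real N * real m)" .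
    hence "k\<^sup>2 \<le> 64 * real N * real m" using Npos by simp
    also have "\<dots> \<le> 64 * z ^ 5 * (2 * z ^ 3)" using m2 z1 unfolding zN[symmetric] by (intro mult_left_mono) auto
    also have "\<dots> = 128 * z ^ 8" by (simp flip: power_add)
    also have "\<dots> \<le> 144 * z ^ 8" using z1 by simp
    also have "\<dots> = (12 * z ^ 4)\<^sup>2" by (simp add: power_mult_distrib flip: power_mult)
    finally have "k \<le> 12 * z ^ 4" using z1 by (intro power2_le_imp_le[of k]) auto
    thus ?thesis by (simp add: z4 k_def)
  qed
qed

section \<open>Sparse subsets of a grid\<close>

text \<open>A single term of the exponential series gives \<open>s ^ s / fact s \<le> exp s\<close>,
  and \<open>exp 1 \<le> 3\<close>.\<close>

lemma power_self_le_fact: "real s ^ s \<le> 3 ^ s * fact s"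
proof -
  have nonneg: "0 \<le> real s ^ n /\<^sub>R fact n" for n by simp
  have "(\<Sum>n\<in>{s}. real s ^ n /\<^sub>R fact n) \<le> exp (real s)"
    using sum_le_suminf[OF sums_summable[OF exp_converges], of "{s}" "real s"] nonneg
      sums_unique[OF exp_converges[of "real s"]] by simp
  hence "real s ^ s \<le> exp (real s) * fact s" by (simp add: field_simps)
  also have "exp (real s) = exp 1 ^ s" by (simp flip: exp_of_nat_mult)
  also have "\<dots> * fact s \<le> 3 ^ s * fact s"
    using exp_le by (intro mult_right_mono power_mono) auto
  finally show ?thesis .
qed

text \<open>Every column is cut into \<open>t\<close> blocks of \<open>B\<close> cells, and \<open>f\<close> selects one cell of each block.\<close>

definition block_points :: "nat \<Rightarrow> nat \<Rightarrow> nat \<Rightarrow> (nat \<times> nat \<Rightarrow> nat) \<Rightarrow> (nat \<times> nat) set" where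
  "block_points N t B f = (\<lambda>i. (fst i, snd i * B + f i)) ` ({..<N} \<times> {..<t})"

text \<open>The rounding makes this total; the value is only meaningful where the line through \<open>p\<close> and \<open>q\<close>
  meets the column \<open>x\<close> in a grid point.\<close>

definition ordinate :: "nat \<times> nat \<Rightarrow> nat \<times> nat \<Rightarrow> nat \<Rightarrow> nat" where
  "ordinate p q x = nat \<lfloor>real (snd p)
     + (real (snd q) - real (snd p)) * (real x - real (fst p)) / (real (fst q) - real (fst p))\<rfloor>"

lemma turn_emb_ordinate:
  assumes "turn (emb p) (emb q) (emb c) = 0" "fst p \<noteq> fst q"
  shows "snd c = ordinate p q (fst c)"
proof -
  have "real (snd c) = real (snd p)
     + (real (snd q) - real (snd p)) * (real (fst c) - real (fst p)) / (real (fst q) - real (fst p))"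
    using assms by (simp add: turn_def field_simps)
  thus ?thesis unfolding ordinate_def by (metis floor_of_nat nat_int)
qed

text \<open>Quotient and remainder by \<open>B\<close> recover the block and the selected cell,
  because \<open>f i < B\<close>.\<close>

lemma block_points_cases:
  assumes "c \<in> block_points N t B f" "f \<in> ({..<N} \<times> {..<t}) \<rightarrow>\<^sub>E {..<B}"
  shows "fst c < N" "snd c div B < t" "snd c mod B = f (fst c, snd c div B)"
proof -
  obtain i where i: "i \<in> {..<N} \<times> {..<t}" "c = (fst i, snd i * B + f i)"
    using assms(1) unfolding block_points_def by blast
  have "f i < B" using PiE_mem[OF assms(2) i(1)] by simp
  hence "snd c div B = snd i" "snd c mod B = f i" by (simp_all add: i(2))
  thus "fst c < N" "snd c div B < t" "snd c mod B = f (fst c, snd c div B)"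
    using i by (simp_all add: mem_Times_iff)
qed

lemma card_block_points:
  assumes "f \<in> ({..<N} \<times> {..<t}) \<rightarrow>\<^sub>E {..<B}"
  shows "card (block_points N t B f) = N * t"
proof -
  have "inj_on (\<lambda>i. (fst i, snd i * B + f i)) ({..<N} \<times> {..<t})"
  proof (rule inj_onI)
    fix i j assume i: "i \<in> {..<N} \<times> {..<t}" and j: "j \<in> {..<N} \<times> {..<t}"
      and eq: "(fst i, snd i * B + f i) = (fst j, snd j * B + f j)"
    have "f i < B" "f j < B" using PiE_mem[OF assms i] PiE_mem[OF assms j] by simp_all
    moreover have "(snd i * B + f i) div B = (snd j * B + f j) div B" using eq by simp
    ultimately have "snd i = snd j" by simp
    thus "i = j" using eq by (simp add: prod_eq_iff)
  qed
  thus ?thesis by (simp add: block_points_def card_image card_cartesian_product)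
qed

text \<open>Union bound. A non-vertical line with more than \<open>s\<close> selected points is
  witnessed by two of its points and \<open>s\<close> of its columns, which prescribe
  \<open>f\<close> on \<open>s\<close> blocks. There are at most \<open>N ^ 4 * (N choose s)\<close>
  witnesses, each taking a share \<open>1 / B ^ s\<close> of the choice functions.\<close>

lemma exists_sparse_grid_subset:
  fixes t B s :: nat
  assumes t: "1 \<le> t" "6 * t \<le> s" and B: "1 \<le> B" and N: "N = B * t" and small: "N ^ 4 < 2 ^ s"
  shows "\<exists>A. A \<subseteq> {..<N} \<times> {..<N} \<and> card A = N * t \<and> at_most_on_line s (emb ` A)"
proof -
  let ?I = "{..<N} \<times> {..<t}"
  let ?F = "?I \<rightarrow>\<^sub>E {..<B}"
  let ?A = "block_points N t B"
  define J where "J w = (\<lambda>x. (x, ordinate (fst w) (fst (snd w)) x div B)) ` snd (snd w)"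
    for w :: "(nat \<times> nat) \<times> (nat \<times> nat) \<times> nat set"
  define g where "g w i = ordinate (fst w) (fst (snd w)) (fst i) mod B"
    for w :: "(nat \<times> nat) \<times> (nat \<times> nat) \<times> nat set" and i :: "nat \<times> nat"
  define W where "W = {w \<in> ({..<N} \<times> {..<N}) \<times> ({..<N} \<times> {..<N}) \<times> {X. X \<subseteq> {..<N} \<and> card X = s}. J w \<subseteq> ?I}"
  have grid: "?A f \<subseteq> {..<N} \<times> {..<N}" if f: "f \<in> ?F" for f
  proof
    fix c assume c: "c \<in> ?A f"
    have "snd c < t * B" using block_points_cases(2)[OF c f] B
      by (metis div_less_iff_less_mult less_eq_Suc_le One_nat_def)
    thus "c \<in> {..<N} \<times> {..<N}" using block_points_cases(1)[OF c f] N by (simp add: mem_Times_iff mult.commute)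
  qed
  have finA: "finite (?A f)" for f by (simp add: block_points_def)
  have bad: "\<exists>w\<in>W. \<forall>i\<in>J w. f i = g w i"
    if f: "f \<in> ?F" and notline: "\<not> at_most_on_line s (emb ` ?A f)" for f
  proof -
    have "\<exists>a\<in>emb ` ?A f. \<exists>b\<in>emb ` ?A f. a \<noteq> b \<and> s < card (line_of (emb ` ?A f) a b)"
    proof (rule ccontr)
      assume none: "\<not> ?thesis"
      have "at_most_on_line s (emb ` ?A f)"
      proof (rule at_most_on_lineI)
        show "finite (emb ` ?A f)" using finA by simp
        show "1 \<le> s" using t by simp
        show "card (line_of (emb ` ?A f) a b) \<le> s"
          if "a \<in> emb ` ?A f" "b \<in> emb ` ?A f" "a \<noteq> b" for a b
          using none that not_le_imp_less by blast
      qed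
      thus False using notline by blast
    qed
    then obtain p q where pq: "p \<in> ?A f" "q \<in> ?A f" "emb p \<noteq> emb q"
      "s < card (line_of (emb ` ?A f) (emb p) (emb q))" by blast
    define L where "L = {c \<in> ?A f. turn (emb p) (emb q) (emb c) = 0}"
    have "line_of (emb ` ?A f) (emb p) (emb q) = emb ` L" by (auto simp: line_of_def L_def)
    moreover have "card (emb ` L) = card L" using inj_emb by (meson card_image inj_on_subset subset_UNIV)
    ultimately have cL: "s < card L" using pq(4) by simp
    have finL: "finite L" using finA by (simp add: L_def)
    \<comment> \<open>A column has one selected cell per block, hence only \<open>t \<le> s\<close>
      points.\<close>
    have ne: "fst p \<noteq> fst q"
    proof
      assume eq: "fst p = fst q"
      hence "snd p \<noteq> snd q" using pq(3) by (auto simp: prod_eq_iff)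
      hence vert: "fst c = fst p" if "c \<in> L" for c
        using that eq by (simp add: L_def turn_def)
      have "card L \<le> card {..<t}"
      proof (rule card_inj_on_le[of "\<lambda>c. snd c div B"])
        show "inj_on (\<lambda>c. snd c div B) L"
        proof (rule inj_onI)
          fix c d assume c: "c \<in> L" and d: "d \<in> L" and cd: "snd c div B = snd d div B"
          have "snd c mod B = snd d mod B"
            using block_points_cases(3)[OF _ f, of c] block_points_cases(3)[OF _ f, of d] c d cd vert[OF c] vert[OF d]
            by (simp add: L_def)
          hence "snd c = snd d" using cd by (metis div_mult_mod_eq)
          thus "c = d" using vert[OF c] vert[OF d] by (simp add: prod_eq_iff)
        qed
        show "(\<lambda>c. snd c div B) ` L \<subseteq> {..<t}" using block_points_cases(2)[OF _ f] by (auto simp: L_def)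
      qed simp
      thus False using cL t by simp
    qed
    have ord: "snd c = ordinate p q (fst c)" if "c \<in> L" for c
      using turn_emb_ordinate[OF _ ne] that by (simp add: L_def)
    have "inj_on fst L" using ord by (intro inj_onI) (simp add: prod_eq_iff)
    hence "s \<le> card (fst ` L)" using cL by (simp add: card_image)
    then obtain X where X: "X \<subseteq> fst ` L" "card X = s" by (meson obtain_subset_with_card_n)
    have XL: "x < N \<and> ordinate p q x div B < t \<and> f (x, ordinate p q x div B) = ordinate p q x mod B"
      if x: "x \<in> X" for x
    proof -
      obtain c where c: "c \<in> L" "x = fst c" using X(1) x by blast
      hence "c \<in> ?A f" by (simp add: L_def)
      from block_points_cases[OF this f] show ?thesis using ord[OF c(1)] c(2) by simp
    qed
    have "p \<in> {..<N} \<times> {..<N}" "q \<in> {..<N} \<times> {..<N}" using grid[OF f] pq by blast+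
    moreover have "X \<subseteq> {..<N}" using XL by blast
    moreover have "J (p, q, X) \<subseteq> ?I" using XL by (auto simp: J_def)
    ultimately have "(p, q, X) \<in> W" using X(2) by (simp add: W_def)
    moreover have "\<forall>i\<in>J (p, q, X). f i = g (p, q, X) i" using XL by (auto simp: J_def g_def)
    ultimately show ?thesis by blast
  qed
  have "\<exists>f\<in>?F. at_most_on_line s (emb ` ?A f)"
  proof (rule ccontr)
    assume "\<not> ?thesis"
    hence none: "\<And>f. f \<in> ?F \<Longrightarrow> \<not> at_most_on_line s (emb ` ?A f)" by blast
    have cover: "?F \<subseteq> (\<Union>w\<in>W. {f \<in> ?F. \<forall>i\<in>J w. f i = g w i})"
    proof
      fix f assume f: "f \<in> ?F"
      from bad[OF f none[OF f]] obtain w where "w \<in> W" "\<forall>i\<in>J w. f i = g w i" by blast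
      thus "f \<in> (\<Union>w\<in>W. {f \<in> ?F. \<forall>i\<in>J w. f i = g w i})" using f by blast
    qed
    have finF: "finite ?F" by (intro finite_PiE) auto
    have cJ: "card (J w) = s" "finite (J w)" if "w \<in> W" for w
    proof -
      have "card (J w) = card (snd (snd w))" unfolding J_def by (intro card_image inj_onI) simp
      moreover have "card (snd (snd w)) = s" "snd (snd w) \<subseteq> {..<N}" using that by (auto simp: W_def mem_Times_iff)
      ultimately show "card (J w) = s" "finite (J w)"
        by (auto simp: J_def intro: finite_subset)
    qed
    have finW: "finite W" unfolding W_def
      by (rule finite_subset[of _ "({..<N} \<times> {..<N}) \<times> ({..<N} \<times> {..<N}) \<times> Pow {..<N}"]) auto
    have "card ?F \<le> card (\<Union>w\<in>W. {f \<in> ?F. \<forall>i\<in>J w. f i = g w i})"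
      using finW finF by (intro card_mono[OF _ cover]) auto
    also have "\<dots> \<le> (\<Sum>w\<in>W. card {f \<in> ?F. \<forall>i\<in>J w. f i = g w i})" by (rule card_UN_le[OF finW])
    also have "\<dots> = (\<Sum>w\<in>W. B ^ (N * t - s))"
    proof (rule sum.cong[OF refl])
      fix w assume w: "w \<in> W"
      have "card {f \<in> ?F. \<forall>i\<in>J w. f i = g w i} = card {..<B} ^ (card ?I - card (J w))"
        by (rule card_PiE_prescribed) (use w B in \<open>auto simp: W_def g_def\<close>)
      thus "card {f \<in> ?F. \<forall>i\<in>J w. f i = g w i} = B ^ (N * t - s)"
        using cJ(1)[OF w] by (simp add: card_cartesian_product)
    qed
    also have "\<dots> = card W * B ^ (N * t - s)" by simp
    finally have le1: "B ^ (N * t) \<le> card W * B ^ (N * t - s)"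
      by (simp add: card_PiE card_cartesian_product)
    hence "W \<noteq> {}" using B by auto
    then obtain w where "w \<in> W" by blast
    hence "J w \<subseteq> ?I" "card (J w) = s" using cJ by (simp_all add: W_def)
    hence sN: "s \<le> N * t" using card_mono[of ?I "J w"] by (simp add: card_cartesian_product)
    hence "B ^ (N * t) = B ^ s * B ^ (N * t - s)" by (simp flip: power_add)
    hence le2: "B ^ s \<le> card W" using le1 B by simp
    have "card W \<le> card (({..<N} \<times> {..<N}) \<times> ({..<N} \<times> {..<N}) \<times> {X. X \<subseteq> {..<N} \<and> card X = s})"
      unfolding W_def by (rule card_mono) auto
    also have "\<dots> = N ^ 4 * (N choose s)"
      using n_subsets[of "{..<N}" s] by (simp add: card_cartesian_product power4_eq_xxxx)
    finally have "B ^ s * fact s \<le> N ^ 4 * (N choose s) * fact s" using le2 by simp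
    also have "\<dots> \<le> N ^ 4 * N ^ s" using binomial_fact_pow[of N s] by (simp add: mult.assoc)
    also have "\<dots> = B ^ s * (N ^ 4 * t ^ s)" by (simp add: N power_mult_distrib)
    finally have "fact s \<le> N ^ 4 * t ^ s" using B by simp
    hence "real (fact s) \<le> real (N ^ 4 * t ^ s)" by (simp only: of_nat_le_iff)
    hence fs: "(fact s :: real) \<le> real N ^ 4 * real t ^ s" by simp
    \<comment> \<open>Against \<open>3 ^ s * fact s\<close>, the 6 in \<open>6 * t \<le> s\<close>
      leaves a factor \<open>2 ^ s\<close>, too large for \<open>N ^ 4\<close>.\<close>
    have "(6 * real t) ^ s \<le> real s ^ s" using t(2) by (intro power_mono) (simp_all flip: of_nat_mult)
    also have "\<dots> \<le> 3 ^ s * fact s" by (rule power_self_le_fact)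
    also have "\<dots> \<le> 3 ^ s * (real N ^ 4 * real t ^ s)" using fs by (intro mult_left_mono) auto
    finally have "2 ^ s * (3 ^ s * real t ^ s) \<le> real N ^ 4 * (3 ^ s * real t ^ s)"
      by (simp add: power_mult_distrib mult_ac flip: power_mult_distrib[of 2 3])
    hence "2 ^ s \<le> real N ^ 4" using t(1) by simp
    hence "real (2 ^ s) \<le> real (N ^ 4)" by simp
    hence "2 ^ s \<le> N ^ 4" by (simp only: of_nat_le_iff)
    thus False using small by simp
  qed
  then obtain f where f: "f \<in> ?F" "at_most_on_line s (emb ` ?A f)" by blast
  show ?thesis using grid[OF f(1)] card_block_points[OF f(1)] f(2) by (intro exI[of _ "?A f"] conjI)
qed

lemma at_most_on_line_subset:
  assumes "at_most_on_line s P" "P' \<subseteq> P" "finite P"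
  shows "at_most_on_line s P'"
  unfolding at_most_on_line_def
proof (intro allI impI)
  fix L :: "point set" assume "affine L \<and> aff_dim L = 1"
  hence "card (P \<inter> L) \<le> s" using assms(1) by (simp add: at_most_on_line_def)
  moreover have "card (P' \<inter> L) \<le> card (P \<inter> L)" using assms by (intro card_mono) auto
  ultimately show "card (P' \<inter> L) \<le> s" by linarith
qed

section \<open>Asymptotic bounds\<close>

text \<open>With \<open>t\<close> near \<open>s / 6\<close> and \<open>B\<close> near
  \<open>n / t ^ 2\<close>, the sparse subset has \<open>N * t \<ge> n\<close> points and is trimmed
  to \<open>n\<close>, while \<open>N\<close> stays of order \<open>n / s\<close>.\<close>

lemma h_le_grid:
  fixes n s :: nat and D :: real
  assumes s: "6 \<le> s" "s \<le> n" "(real s)\<^sup>2 \<le> D * real n" and small: "(13 * real n) ^ 4 < 2 ^ s" and D: "0 \<le> D"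
  shows "real (h n s) \<le> 12 * (12 + D) powr (4/5) * (real n / real s) powr (4/5)"
proof -
  define t where "t = s div 6"
  define B where "B = n div t\<^sup>2 + 1"
  define N where "N = B * t"
  have t: "1 \<le> t" "6 * t \<le> s" using s(1) by (auto simp: t_def)
  have "s \<le> 12 * t" using dividend_less_div_times[of 6 s] t(1) by (simp add: t_def)
  hence ts: "real s / 12 \<le> real t" by linarith
  have "n < B * t\<^sup>2" using t(1) unfolding B_def by (simp add: dividend_less_div_times)
  hence Nt: "n \<le> N * t" by (simp add: N_def power2_eq_square mult.assoc)
  have spos: "real s > 0" using s(1) by simp
  have "real (n div t\<^sup>2) \<le> real n / (real t)\<^sup>2"
    using of_nat_div_le_of_nat[of n "t\<^sup>2", where ?'a = real] by simp
  hence "real B \<le> real n / (real t)\<^sup>2 + 1" by (simp add: B_def)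
  hence "real N \<le> (real n / (real t)\<^sup>2 + 1) * real t" unfolding N_def of_nat_mult by (intro mult_right_mono) auto
  also have "\<dots> = real n / real t + real t" using t(1) by (simp add: power2_eq_square field_simps)
  also have "\<dots> \<le> real n / (real s / 12) + real s"
    using ts spos t by (intro add_mono divide_left_mono mult_pos_pos) auto
  finally have N1: "real N \<le> 12 * (real n / real s) + real s" by (simp add: mult.commute)
  \<comment> \<open>The term \<open>s\<close> left by rounding \<open>B\<close> up is absorbed
    through \<open>s = O(sqrt n)\<close>.\<close>
  have "real s \<le> D * (real n / real s)" using s(3) spos by (simp add: field_simps power2_eq_square)
  hence N2: "real N \<le> (12 + D) * (real n / real s)" using N1 unfolding distrib_right by linarith
  have "12 * (real n / real s) \<le> 12 * real n"
  proof -
    have "real n / real s \<le> real n / 1" using s(1) by (intro divide_left_mono) auto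
    thus ?thesis by simp
  qed
  \<comment> \<open>This is the source of the 13 in \<open>small\<close>: 12 from
    \<open>n / s \<le> n\<close> and 1 from \<open>s \<le> n\<close>.\<close>
  hence "real N \<le> 13 * real n" using N1 s(2) by simp
  hence "real N ^ 4 \<le> (13 * real n) ^ 4" by (intro power_mono) auto
  hence "real N ^ 4 < 2 ^ s" using small by linarith
  hence "real (N ^ 4) < real (2 ^ s)" by simp
  hence small': "N ^ 4 < 2 ^ s" by (simp only: of_nat_less_iff)
  obtain A where A: "A \<subseteq> {..<N} \<times> {..<N}" "card A = N * t" "at_most_on_line s (emb ` A)"
    using exists_sparse_grid_subset[OF t _ N_def small'] by (auto simp: B_def)
  obtain A' where A': "A' \<subseteq> A" "card A' = n" using Nt A(2) by (metis obtain_subset_with_card_n)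
  have finA: "finite A" using A(1) finite_subset by blast
  have inj: "inj_on emb S" for S using inj_emb by (meson inj_on_subset subset_UNIV)
  have N1': "N \<ge> 1" using t by (simp add: N_def B_def)
  show ?thesis
  proof (rule h_le)
    show "finite (emb ` A')" using finite_subset[OF A'(1) finA] by simp
    show "card (emb ` A') = n" using A'(2) card_image[OF inj] by simp
    show "at_most_on_line s (emb ` A')"
      by (rule at_most_on_line_subset[OF A(3)]) (use A'(1) finA in auto)
    fix Q assume Q: "Q \<subseteq> emb ` A'" "distinct_slopes Q"
    then obtain A'' where A'': "A'' \<subseteq> A'" "Q = emb ` A''" by (metis subset_image_iff)
    have "real (card A'') \<le> 12 * real N powr (4/5)"
      by (rule grid_distinct_slopes) (use A'' A' A Q N1' in auto)
    also have "\<dots> \<le> 12 * ((12 + D) * (real n / real s)) powr (4/5)"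
      using N2 by (intro mult_left_mono powr_mono2) auto
    also have "\<dots> = 12 * (12 + D) powr (4/5) * (real n / real s) powr (4/5)"
      by (subst powr_mult) (use D in auto)
    finally show "real (card Q) \<le> 12 * (12 + D) powr (4/5) * (real n / real s) powr (4/5)"
      using A''(2) card_image[OF inj] by simp
  qed
qed

text \<open>Take for \<open>r\<close> the rounded-up cube root of \<open>K * n ^ 2 * ln s\<close>;
  then \<open>n / (2 * r)\<close> has order \<open>(n / ln s) powr (1/3)\<close>. The hypothesis
  \<open>8 * K * ln s \<le> n\<close> keeps \<open>r \<le> n\<close>.\<close>

lemma h_ge_cube_root:
  fixes n s :: nat and D :: real
  defines "K \<equiv> 144 * (2304 + 12 * D)"
  assumes s: "2 \<le> s" "(real s)\<^sup>2 \<le> D * real n" and D: "0 \<le> D" and n: "1 \<le> n" "8 * K * ln (real s) \<le> real n"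
  shows "(real n / ln (real s)) powr (1/3) \<le> 4 * K powr (1/3) * real (h n s)"
proof -
  define Y where "Y = K * (real n)\<^sup>2 * ln (real s)"
  define y where "y = Y powr (1/3)"
  define r where "r = nat \<lceil>y\<rceil>"
  have "2 / 3 \<le> ln (2::real)" by (rule ln2_ge_two_thirds)
  also have "\<dots> \<le> ln (real s)" using s(1) by simp
  finally have ln: "2 / 3 \<le> ln (real s)" .
  have K: "K \<ge> 2" using D by (simp add: K_def)
  \<comment> \<open>\<open>Y \<ge> 1\<close> ensures that rounding up \<open>y\<close> at most
    doubles it.\<close>
  have "1 * 1 \<le> (real n)\<^sup>2 * (K * ln (real s))"
  proof (rule mult_mono)
    show "1 \<le> (real n)\<^sup>2" using n(1) by simp
    have "2 * (2 / 3) \<le> K * ln (real s)" using K ln by (intro mult_mono) auto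
    thus "1 \<le> K * ln (real s)" by simp
  qed auto
  hence Y1: "1 \<le> Y" by (simp add: Y_def mult_ac)
  have y1: "1 \<le> y" using Y1 by (simp add: y_def ge_one_powr_ge_zero)
  have y3: "y ^ 3 = Y" using Y1 by (simp add: y_def powr_power)
  have ry: "y \<le> real r" unfolding r_def by (rule real_nat_ceiling_ge)
  have "real r < y + 1" using y1 unfolding r_def by linarith
  hence r2: "real r \<le> 2 * y" using y1 by linarith
  have rpos: "0 < r" using ry y1 by (cases r) auto
  have "(2 * y) ^ 3 = (real n)\<^sup>2 * (8 * K * ln (real s))" by (simp add: power_mult_distrib y3 Y_def)
  also have "\<dots> \<le> (real n)\<^sup>2 * real n" using n(2) by (intro mult_left_mono) auto
  also have "\<dots> = real n ^ 3" by (simp add: power2_eq_square power3_eq_cube)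
  finally have "2 * y \<le> real n" using y1 by (subst (asm) power_mono_iff) auto
  hence rn: "r \<le> n" using r2 by linarith
  have "y ^ 3 \<le> real r ^ 3" using ry y1 by (intro power_mono) auto
  hence r3: "144 * (2304 + 12 * D) * (real n)\<^sup>2 * ln (real s) \<le> real r ^ 3"
    unfolding y3 Y_def K_def .
  define k where "k = nat \<lceil>real n / (2 * real r)\<rceil>"
  have "k \<le> h n s"
  proof (rule h_ge[OF s(1)])
    fix P assume P: "finite P" "card P = n" "at_most_on_line s P"
    obtain Q where Q: "Q \<subseteq> P" "card P \<le> 2 * r * card Q" "distinct_slopes Q"
      using exists_distinct_slopes[OF P(1,3) s(1) _ D rpos] s(2) rn r3 P(2) by blast
    have "real n \<le> real (2 * r * card Q)" using Q(2) P(2) by (simp only: of_nat_le_iff)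
    hence "real n / (2 * real r) \<le> real (card Q)" using rpos by (simp add: field_simps)
    hence "k \<le> card Q" by (simp add: k_def nat_le_iff ceiling_le_iff)
    thus "\<exists>Q\<subseteq>P. k \<le> card Q \<and> distinct_slopes Q" using Q by blast
  qed
  moreover have "real n / (2 * real r) \<le> real k" unfolding k_def by (rule real_nat_ceiling_ge)
  ultimately have "real n / (2 * real r) \<le> real (h n s)" by linarith
  hence "real n \<le> real (h n s) * (2 * real r)" using rpos by (simp add: field_simps)
  also have "\<dots> \<le> real (h n s) * (2 * (2 * y))" using r2 by (intro mult_left_mono) auto
  finally have hn: "real n \<le> 4 * real (h n s) * y" by simp
  have "(real n / ln (real s)) powr (1/3) * y = (real n / ln (real s) * Y) powr (1/3)"
    unfolding y_def using Y1 ln by (subst powr_mult) auto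
  also have "real n / ln (real s) * Y = K * real n ^ 3"
    using ln by (simp add: Y_def power2_eq_square power3_eq_cube)
  also have "\<dots> powr (1/3) = K powr (1/3) * real n"
    using K n(1) by (simp add: powr_mult powr_powr flip: powr_numeral)
  also have "\<dots> \<le> K powr (1/3) * (4 * real (h n s) * y)" using hn by (intro mult_left_mono) auto
  finally have "(real n / ln (real s)) powr (1/3) * y \<le> (4 * K powr (1/3) * real (h n s)) * y"
    by (simp add: mult_ac)
  thus ?thesis using y1 by (simp add: mult_le_cancel_right)
qed

theorem theorem1p6:
  fixes s :: "nat \<Rightarrow> nat"
  assumes "\<forall>\<^sub>F n in at_top. 2 \<le> s n \<and> s n \<le> n"
    and "(\<lambda>n. real (s n)) \<in> O(\<lambda>n. sqrt (real n))"
  shows "(\<lambda>n. real (h n (s n))) \<in> \<Omega>(\<lambda>n. (real n / ln (real (s n))) powr (1/3))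
    \<and> (\<lambda>n. real (h n (s n))) \<in>
        O(\<lambda>n. if real (s n) \<le> real n powr (3/8) then sqrt (real n)
              else (real n / real (s n)) powr (4/5))"
proof
  obtain C where "C > 0" and C: "\<forall>\<^sub>F n in at_top. norm (real (s n)) \<le> C * norm (sqrt (real n))"
    using landau_o.bigE[OF assms(2)] by blast
  define D where "D = C\<^sup>2"
  have D: "0 \<le> D" by (simp add: D_def)
  have sD: "\<forall>\<^sub>F n in at_top. (real (s n))\<^sup>2 \<le> D * real n"
    using C
  proof eventually_elim
    case (elim n)
    hence "(real (s n))\<^sup>2 \<le> (C * sqrt (real n))\<^sup>2" by (intro power_mono) auto
    thus ?case by (simp add: power_mult_distrib D_def)
  qed
  define K where "K = 144 * (2304 + 12 * D)"
  have "\<forall>\<^sub>F n in at_top. 8 * K * ln (real n) \<le> real n" by real_asymp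
  hence "\<forall>\<^sub>F n in at_top. norm ((real n / ln (real (s n))) powr (1/3)) \<le> 4 * K powr (1/3) * norm (real (h n (s n)))"
    using assms(1) sD eventually_ge_at_top[of 1]
  proof eventually_elim
    case (elim n)
    have "K \<ge> 0" using D by (simp add: K_def)
    hence "8 * K * ln (real (s n)) \<le> 8 * K * ln (real n)" using elim by (intro mult_left_mono) auto
    hence "8 * K * ln (real (s n)) \<le> real n" using elim by linarith
    thus ?case using h_ge_cube_root[of "s n" D n] elim D by (simp add: K_def)
  qed
  thus "(\<lambda>n. real (h n (s n))) \<in> \<Omega>(\<lambda>n. (real n / ln (real (s n))) powr (1/3))"
    unfolding bigomega_iff_bigo by (rule bigoI)
  \<comment> \<open>In the second range \<open>s n\<close> exceeds \<open>n powr (3/8)\<close>, so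
    this growth comparison supplies the hypothesis \<open>small\<close> of
    \<open>h_le_grid\<close>.\<close>
  have "\<forall>\<^sub>F n in at_top. (13 * real n) ^ 4 < 2 powr (real n powr (3/8))" by real_asymp
  moreover have "\<forall>\<^sub>F n in at_top. 6 \<le> real n powr (3/8)" by real_asymp
  \<comment> \<open>One constant serves both ranges: the 3 absorbs \<open>2 * sqrt n + 1\<close> for
    \<open>n \<ge> 1\<close>, the other summand is that of the grid.\<close>
  ultimately have "\<forall>\<^sub>F n in at_top. norm (real (h n (s n))) \<le> (3 + 12 * (12 + D) powr (4/5)) *
      norm (if real (s n) \<le> real n powr (3/8) then sqrt (real n) else (real n / real (s n)) powr (4/5))"
    using assms(1) sD eventually_ge_at_top[of 1]
  proof eventually_elim
    case (elim n)
    show ?case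
    proof (cases "real (s n) \<le> real n powr (3/8)")
      case True
      have "real (h n (s n)) \<le> 2 * sqrt (real n) + 1" using h_le_sqrt elim by blast
      also have "\<dots> \<le> 3 * sqrt (real n)" using elim by simp
      also have "\<dots> \<le> (3 + 12 * (12 + D) powr (4/5)) * sqrt (real n)" by (intro mult_right_mono) auto
      finally show ?thesis using True by simp
    next
      case False
      have "2 powr (real n powr (3/8)) \<le> 2 powr (real (s n))" using False by (intro powr_mono) auto
      hence "(13 * real n) ^ 4 < 2 ^ s n" using elim by (simp add: powr_realpow)
      moreover have "6 \<le> s n" using False elim by linarith
      ultimately have "real (h n (s n)) \<le> 12 * (12 + D) powr (4/5) * (real n / real (s n)) powr (4/5)"
        using elim D by (intro h_le_grid) auto
      also have "\<dots> \<le> (3 + 12 * (12 + D) powr (4/5)) * (real n / real (s n)) powr (4/5)"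
        by (intro mult_right_mono) auto
      finally show ?thesis using False by simp
    qed
  qed
  thus "(\<lambda>n. real (h n (s n))) \<in>
        O(\<lambda>n. if real (s n) \<le> real n powr (3/8) then sqrt (real n)
              else (real n / real (s n)) powr (4/5))"
    by (rule bigoI)
qed

end
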